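(* Let $N=2^{J-1}$ with $J\ge 2$, and let $\mathbf{x}\in\mathbb{R}^N$ have a one-block support of length $m<N$. Set $\mathbf{y}=(\mathbf{x}^T,(\mathbf{J}_N\mathbf{x})^T)^T\in\mathbb{R}^{2N}$ and assume that $\mathbf{y}$ satisfies the non-cancellation condition: for every $k\in\{0,\dots,2N-1\}$ with $y_k\neq 0$, $$y^{(j)}_{k\bmod 2^j}=\sum_{l=0}^{2^{J-j}-1} y_{(k \bmod 2^j)+2^j l}\neq 0\qquad\text{for all } j\in\{0,\dots,J\}.$$ Further, assume that there is no a priori knowledge of the support length $m$ of $\mathbf{x}$. Then the algorithm "Sparse FFT for Vectors with Reflected Block Support" (the specific procedure given in the context, which computes $\mathbf{y}$ from $\widehat{\mathbf{y}}=\mathbf{F}_{2N}\mathbf{y}$) has a runtime of $\mathcal{O}\left(m\log m\log\frac{2N}{m}\right)$ and uses $\mathcal{O}\left(m\log\frac{2N}{m}\right)$ samples of $\widehat{\mathbf{y}}$.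
   Context: Basic notation. For indices $a,b\in\{0,\dots,n-1\}$ of a vector of length $n$, $I_{a,b}=\{a,(a+1)\bmod n,\dots,b\}$ is a periodic interval. A vector $\mathbf{x}\in\mathbb{R}^N$ has a one-block support of length $m$ if $x_k=0$ for all $k\notin I_{\mu,\nu}$ for some $\mu\in\{0,\dots,N-1\}$, $\nu=(\mu+m-1)\bmod N$, with $m$ the (uniquely determined) smallest such length; zeros inside the interval are allowed. $\mathbf{J}_n=(\delta_{k,n-1-l})_{k,l=0}^{n-1}$ is the counter identity, $\omega_n=e^{-2\pi i/n}$, $\mathbf{F}_n=(\omega_n^{kl})_{k,l=0}^{n-1}$, and IFFT denotes a fast algorithm applying $\mathbf{F}_n^{-1}$ in $\mathcal{O}(n\log n)$ operations. For $j\in\{0,\dots,J\}$ the periodization $\mathbf{y}^{(j)}\in\mathbb{R}^{2^j}$ of $\mathbf{y}$ has entries $y^{(j)}_k=\sum_{l=0}^{2^{J-j}-1}y_{k+2^jl}$; thus $\mathbf{y}^{(J)}=\mathbf{y}$. Write $\mathbf{y}^{(j+1)}_{(0)},\mathbf{y}^{(j+1)}_{(1)}\in\mathbb{R}^{2^j}$ for the first and second half of $\mathbf{y}^{(j+1)}$. The algorithm. Input: access to the entries of $\widehat{\mathbf{y}}$, and a noise threshold $\varepsilon>0$ such that $|y^{(j)}_{k\bmod 2^j}|>\varepsilon$ for all $j$ whenever $y_k\ne0$. (If a lower bound $2^{b-1}\le m$ were known, the algorithm would start from $\mathbf{y}^{(b)}$, computed by an IFFT of length $2^b$; without such knowledge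 $b=0$.) The algorithm keeps a description of the support of $\mathbf{y}^{(j)}$: either one block $I_{\mu^{(j)},2^j-1-\mu^{(j)}}$ of length $m^{(j)}$, centered around the middle (indices $2^{j-1}-1$, $2^{j-1}$) or around the boundary (indices $2^j-1$, $0$) of the vector, or two separated blocks of length $n^{(j)}$, which are reflections of each other, the first one starting at $\mu^{(j)}$. Start: $\mathbf{y}^{(0)}=\widehat{y}_0$, with one block, $\mu^{(0)}=0$, $m^{(0)}=1$. For $j=0,\dots,J-1$ compute $\mathbf{y}^{(j+1)}$ and then detect its support. In the following, "thresholded" means that entries of absolute value at most $\varepsilon$ are set to $0$. (a) One block, $m^{(j)}>2^{j-1}$: $\mathbf{a}=\mathrm{diag}(\omega_{2^{j+1}}^{-l})_{l=0}^{2^j-1}\,\mathrm{IFFT}\big[(\widehat{y}_{2^{J-j-1}(2k+1)})_{k=0}^{2^j-1}\big]$; $\mathbf{y}^{(j+1)}_{(0)}$ is the thresholded vector $\frac12\mathrm{Re}(\mathbf{y}^{(j)}+\mathbf{a})$, and $\mathbf{y}^{(j+1)}_{(1)}=\mathbf{J}_{2^j}\mathbf{y}^{(j+1)}_{(0)}$. (b) One block, $m^{(j)}\le 2^{j-1}$: let $L=\lceil\log_2 m^{(j)}\rceil$, $\mathbf{z}=(y^{(j)}_{(\mu^{(j)}+r)\bmod 2^j})_{r=0}^{2^L-1}$, $\mathbf{v}=(\widehat{y}_{2^{J-L}p+2^{J-j-1}})_{p=0}^{2^L-1}$, and $$\mathbf{a}=\mathrm{diag}\big(\omega_{2^{j+1}}^{-((\mu^{(j)}+r)\bmod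 2^j)}\big)_{r=0}^{2^L-1}\,\mathrm{IFFT}\big[\mathrm{diag}(\omega_{2^L}^{-p\mu^{(j)}})_{p=0}^{2^L-1}\mathbf{v}\big].$$ Let $\mathbf{w}$ be the thresholded vector $\frac12\mathrm{Re}(\mathbf{z}+\mathbf{a})$. For $k\in\{0,\dots,2^L-1\}$ the entry of $\mathbf{y}^{(j+1)}_{(0)}$ with index $(\mu^{(j)}+k)\bmod 2^j$ and the entry of $\mathbf{y}^{(j+1)}_{(1)}$ with index $2^j-1-((\mu^{(j)}+k)\bmod 2^j)$ are set to $w_k$; all other entries are $0$. (c) Two blocks: find a nonzero $\widehat{y}_{2^{J-j-1}(2k_0+1)}$ by taking $k_0$ to maximize $|\widehat{y}_{2^{J-j-1}(2k+1)}|$ over $k\in\{0,\dots,2n^{(j)}-1\}$. Compute $$u=\sum_{l=\mu^{(j)}}^{\mu^{(j)}+n^{(j)}-1}\omega_{2^{j+1}}^{(2k_0+1)l}y^{(j)}_l+\sum_{l=2^{j+1}-n^{(j)}-\mu^{(j)}}^{2^{j+1}-1-\mu^{(j)}}\omega_{2^{j+1}}^{(2k_0+1)l}y^{(j)}_{l-2^j}.$$ Put $\lambda=\mu^{(j)}$ if $|u-\widehat{y}_{2^{J-j-1}(2k_0+1)}|<|u+\widehat{y}_{2^{J-j-1}(2k_0+1)}|$ and $\lambda=2^j+\mu^{(j)}$ otherwise. Set $y^{(j+1)}_k=y^{(j)}_{k\bmod 2^j}$ for $k\in\{\lambda,\dots,\lambda+n^{(j)}-1\}\cup\{2^{j+1}-n^{(j)}-\lambda,\dots,2^{j+1}-1-\lambda\}$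 and $y^{(j+1)}_k=0$ otherwise. Support detection for $\mathbf{y}^{(j+1)}$ (an index $k$ is significant if $|y^{(j+1)}_k|>\varepsilon$). (A1) $\mathbf{y}^{(j)}$ has one block with $m^{(j)}<2^j$ centered around the middle: $\mathbf{y}^{(j+1)}$ has two blocks; with $t_1$ and $t_K$ the smallest and largest significant index in $\{\mu^{(j)},\dots,2^j-1-\mu^{(j)}\}$, set $\mu^{(j+1)}=t_1$, $n^{(j+1)}=t_K-t_1+1$. (A2) $m^{(j)}=2^j$, $j<J-1$: $\mathbf{y}^{(j+1)}$ has one block. Let $t_1<\dots<t_{2K}$ be the significant indices of $\mathbf{y}^{(j+1)}$, with $t_K\le 2^j-1<t_{K+1}$, and put $d_0=t_{K+1}-t_K$, $d_1=(t_1-t_{2K})\bmod 2^{j+1}$. If $d_0=d_1$, or if the shorter of the lengths $t_{2K}-t_1+1$ and $2^{j+1}-t_{K+1}+t_K+1$ exceeds $2^j$, set $\mu^{(j+1)}=0$, $m^{(j+1)}=2^{j+1}$. Otherwise set $\mu^{(j+1)}=t_1$, $m^{(j+1)}=t_{2K}-t_1+1$ if $d_0<d_1$, and $\mu^{(j+1)}=t_{K+1}$, $m^{(j+1)}=2^{j+1}-t_{K+1}+t_K+1$ if $d_0>d_1$. (A3) $\mathbf{y}^{(j)}$ has one block with $m^{(j)}<2^j$ centered around the boundary, $j<J-1$: $\mathbf{y}^{(j+1)}$ has one block with $m^{(j+1)}=m^{(j)}$, and $\mu^{(j+1)}$ is that one of $\mu^{(j)}$, $2^j+\mu^{(j)}$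 for which the sum of $|y^{(j+1)}_k|$ over the periodic interval of length $m^{(j)}$ starting there is larger. (B) $\mathbf{y}^{(j)}$ has two blocks: so does $\mathbf{y}^{(j+1)}$, with $n^{(j+1)}=n^{(j)}$ and $\mu^{(j+1)}=\mu^{(j)}$ if $\lambda=\mu^{(j)}$, $\mu^{(j+1)}=2^j-n^{(j)}-\mu^{(j)}$ otherwise. For $j=J-1$ in the situations of (A2) and (A3), the support of $\mathbf{y}$ is read off from the significant entries among those just computed; this does not affect the vector $\mathbf{y}=\mathbf{y}^{(J)}$, which is the output. Runtime means the number of arithmetical operations; samples are the entries of $\widehat{\mathbf{y}}$ that are used. *)

theory Defs
  imports Complex_Main "HOL-Library.Monad_Syntax"
begin

section \<open>Vectors\<close>

text \<open>
  Vectors of length \<open>n\<close> are lists of length \<open>n\<close>, indexed from \<open>0\<close>. The counter identity acts as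
  \<^const>\<open>rev\<close>.
\<close>

definition omega :: "nat \<Rightarrow> complex" where
  "omega n = exp (- 2 * pi * \<i> / of_nat n)"

definition dft :: "complex list \<Rightarrow> complex list" where
  "dft v = map (\<lambda>k. \<Sum>l<length v. omega (length v) ^ (k * l) * v ! l) [0..<length v]"

definition periodic_interval :: "nat \<Rightarrow> nat \<Rightarrow> nat \<Rightarrow> nat set" where
  "periodic_interval n a b = {(a + i) mod n | i. i \<le> (b + n - a) mod n}"

definition supported_in_block :: "real list \<Rightarrow> nat \<Rightarrow> bool" where
  "supported_in_block x m \<longleftrightarrow> 1 \<le> m \<and> m \<le> length x \<and>
     (\<exists>\<mu><length x. \<forall>k<length x.
        k \<notin> periodic_interval (length x) \<mu> ((\<mu> + m - 1) mod length x) \<longrightarrow> x ! k = 0)"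

text \<open>
  Periodic intervals are nonempty, so the zero vector has one-block support of length \<open>1\<close>.
\<close>

definition one_block_support :: "real list \<Rightarrow> nat \<Rightarrow> bool" where
  "one_block_support x m \<longleftrightarrow> supported_in_block x m \<and> (\<forall>m'<m. \<not> supported_in_block x m')"

definition reflected :: "real list \<Rightarrow> real list" where
  "reflected x = x @ rev x"

definition periodization :: "nat \<Rightarrow> real list \<Rightarrow> nat \<Rightarrow> real list" where
  "periodization J y j = map (\<lambda>k. \<Sum>l<2 ^ (J - j). y ! (k + 2 ^ j * l)) [0..<2 ^ j]"

definition non_cancelling :: "nat \<Rightarrow> real list \<Rightarrow> bool" where
  "non_cancelling J y \<longleftrightarrow>
     (\<forall>k<2 ^ J. y ! k \<noteq> 0 \<longrightarrow> (\<forall>j\<le>J. periodization J y j ! (k mod 2 ^ j) \<noteq> 0))"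

definition noise_threshold :: "nat \<Rightarrow> real list \<Rightarrow> real \<Rightarrow> bool" where
  "noise_threshold J y \<epsilon> \<longleftrightarrow> \<epsilon> > 0 \<and>
     (\<forall>k<2 ^ J. y ! k \<noteq> 0 \<longrightarrow> (\<forall>j\<le>J. \<bar>periodization J y j ! (k mod 2 ^ j)\<bar> > \<epsilon>))"


section \<open>Computations with operation and sample count\<close>

text \<open>
  A computation carries its result, the number of operations performed, and the set of indices at
  which the input vector was sampled. One operation is an arithmetical operation on real or complex
  numbers (including conversions, real parts, absolute values, comparisons and the evaluation of a
  power of a root of unity) or one access to an input entry. Integer arithmetic on indices is not
  counted separately: every loop iteration below contains at least one counted operation and only
  boundedly many index operations.
\<close>

datatype 'a comp = Comp (result: 'a) (runtime: nat) (samples: "nat set")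

definition return :: "'a \<Rightarrow> 'a comp" where
  "return a = Comp a 0 {}"

definition bind_comp :: "'a comp \<Rightarrow> ('a \<Rightarrow> 'b comp) \<Rightarrow> 'b comp" where
  "bind_comp c f = (let d = f (result c)
     in Comp (result d) (runtime c + runtime d) (samples c \<union> samples d))"

adhoc_overloading Monad_Syntax.bind \<rightleftharpoons> bind_comp

definition op1 :: "('a \<Rightarrow> 'b) \<Rightarrow> 'a \<Rightarrow> 'b comp" where
  "op1 f a = Comp (f a) 1 {}"

definition op2 :: "('a \<Rightarrow> 'b \<Rightarrow> 'c) \<Rightarrow> 'a \<Rightarrow> 'b \<Rightarrow> 'c comp" where
  "op2 f a b = Comp (f a b) 1 {}"

definition query :: "(nat \<Rightarrow> complex) \<Rightarrow> nat \<Rightarrow> complex comp" where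
  "query yh i = Comp (yh i) 1 {i}"

primrec mapM :: "('a \<Rightarrow> 'b comp) \<Rightarrow> 'a list \<Rightarrow> 'b list comp" where
  "mapM f [] = return []"
| "mapM f (a # as) = do { b \<leftarrow> f a; bs \<leftarrow> mapM f as; return (b # bs) }"

primrec filterM :: "('a \<Rightarrow> bool comp) \<Rightarrow> 'a list \<Rightarrow> 'a list comp" where
  "filterM p [] = return []"
| "filterM p (a # as) = do { b \<leftarrow> p a; bs \<leftarrow> filterM p as; return (if b then a # bs else bs) }"

primrec foldM :: "('s \<Rightarrow> 'a \<Rightarrow> 's comp) \<Rightarrow> 's \<Rightarrow> 'a list \<Rightarrow> 's comp" where
  "foldM f s [] = return s"
| "foldM f s (a # as) = do { s' \<leftarrow> f s a; foldM f s' as }"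

text \<open>
  An IFFT is a parameter of the algorithm: it returns the transformed vector together with the
  number of operations used. Only lengths that are powers of two occur. The equation
  \<open>dft w = v\<close> says that \<open>w\<close> is the inverse Fourier matrix applied to \<open>v\<close>; the maximum only matters
  for length \<open>1\<close>.
\<close>

type_synonym ifft = "complex list \<Rightarrow> complex list \<times> nat"

definition fast_ifft :: "ifft \<Rightarrow> bool" where
  "fast_ifft ifft \<longleftrightarrow>
     (\<forall>q v. length v = 2 ^ q \<longrightarrow> length (fst (ifft v)) = length v \<and> dft (fst (ifft v)) = v) \<and>
     (\<exists>c::real. \<forall>q v. length v = 2 ^ q \<longrightarrow>
        real (snd (ifft v)) \<le> c * real (length v) * max 1 (log 2 (real (length v))))"

definition apply_ifft :: "ifft \<Rightarrow> complex list \<Rightarrow> complex list comp" where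
  "apply_ifft ifft v = Comp (fst (ifft v)) (snd (ifft v)) {}"


section \<open>The algorithm\<close>

text \<open>
  The vector of the current level \<open>j\<close> is a function on indices that vanishes from \<open>2 ^ j\<close> on.
\<close>

type_synonym vec = "nat \<Rightarrow> real"

definition root_power :: "nat \<Rightarrow> int \<Rightarrow> complex comp" where
  "root_power n e = op1 ((powi) (omega n)) e"

definition thresholded :: "real \<Rightarrow> real \<Rightarrow> real comp" where
  "thresholded \<epsilon> r = do { a \<leftarrow> op1 abs r; b \<leftarrow> op2 (\<le>) a \<epsilon>; return (if b then 0 else r) }"

definition significant :: "real \<Rightarrow> vec \<Rightarrow> nat \<Rightarrow> bool comp" where
  "significant \<epsilon> y k = do { a \<leftarrow> op1 abs (y k); op2 (>) a \<epsilon> }"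

definition half_Re_sum :: "real \<Rightarrow> complex \<Rightarrow> real comp" where
  "half_Re_sum r a = do {
     z \<leftarrow> op1 complex_of_real r;
     s \<leftarrow> op2 (+) z a;
     t \<leftarrow> op1 Re s;
     op2 (/) t 2 }"

text \<open>\<open>scatter is ws\<close> has entry \<open>ws ! r\<close> at index \<open>is ! r\<close> and all other entries zero.\<close>

definition scatter :: "nat list \<Rightarrow> real list \<Rightarrow> vec" where
  "scatter is ws = (\<lambda>k. case map_of (zip is ws) k of None \<Rightarrow> 0 | Some w \<Rightarrow> w)"

text \<open>
  \<open>One_Block \<mu> m\<close> is a block of length \<open>m\<close> starting at \<open>\<mu>\<close>; if \<open>m < 2 ^ j\<close>, it is centered around the
  middle iff it does not wrap around, that is, iff \<open>\<mu> < 2 ^ j - \<mu>\<close>, and otherwise around the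
  boundary. \<open>Two_Blocks \<mu> n\<close> are two blocks of length \<open>n\<close>, the first one starting at \<open>\<mu>\<close>, the second
  one being its reflection. \<open>Explicit\<close> is the list of significant indices read off at the last level.
\<close>

datatype support = One_Block nat nat | Two_Blocks nat nat | Explicit "nat list"

text \<open>The steps for one block return the next vector and the indices of the entries computed.\<close>

definition long_block_step ::
  "ifft \<Rightarrow> nat \<Rightarrow> real \<Rightarrow> (nat \<Rightarrow> complex) \<Rightarrow> nat \<Rightarrow> vec \<Rightarrow> (vec \<times> nat list) comp" where
  "long_block_step ifft J \<epsilon> yh j y = do {
     v \<leftarrow> mapM (\<lambda>k. query yh (2 ^ (J - j - 1) * (2 * k + 1))) [0..<2 ^ j];
     c \<leftarrow> apply_ifft ifft v;
     w \<leftarrow> mapM (\<lambda>l. do {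
            e \<leftarrow> root_power (2 ^ (j + 1)) (- int l);
            a \<leftarrow> op2 (*) e (c ! l);
            h \<leftarrow> half_Re_sum (y l) a;
            thresholded \<epsilon> h }) [0..<2 ^ j];
     return (scatter [0..<2 ^ (j + 1)] (w @ rev w), [0..<2 ^ (j + 1)]) }"

definition short_block_step ::
  "ifft \<Rightarrow> nat \<Rightarrow> real \<Rightarrow> (nat \<Rightarrow> complex) \<Rightarrow> nat \<Rightarrow> vec \<Rightarrow> nat \<Rightarrow> nat
     \<Rightarrow> (vec \<times> nat list) comp" where
  "short_block_step ifft J \<epsilon> yh j y \<mu> m = do {
     let L = nat \<lceil>log 2 (real m)\<rceil>;
     let idx = map (\<lambda>r. (\<mu> + r) mod 2 ^ j) [0..<2 ^ L];
     v \<leftarrow> mapM (\<lambda>p. query yh (2 ^ (J - L) * p + 2 ^ (J - j - 1))) [0..<2 ^ L];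
     u \<leftarrow> mapM (\<lambda>p. do {
            e \<leftarrow> root_power (2 ^ L) (- int (p * \<mu>));
            op2 (*) e (v ! p) }) [0..<2 ^ L];
     c \<leftarrow> apply_ifft ifft u;
     w \<leftarrow> mapM (\<lambda>r. do {
            e \<leftarrow> root_power (2 ^ (j + 1)) (- int (idx ! r));
            a \<leftarrow> op2 (*) e (c ! r);
            h \<leftarrow> half_Re_sum (y (idx ! r)) a;
            thresholded \<epsilon> h }) [0..<2 ^ L];
     let idxs = idx @ map (\<lambda>i. 2 ^ j + (2 ^ j - 1 - i)) idx;
     return (scatter idxs (w @ w), idxs) }"

definition detect_two_blocks ::
  "real \<Rightarrow> nat \<Rightarrow> vec \<Rightarrow> nat \<Rightarrow> support comp" where
  "detect_two_blocks \<epsilon> j y' \<mu> = do {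
     ts \<leftarrow> filterM (significant \<epsilon> y') [\<mu>..<2 ^ j - \<mu>];
     return (if ts = [] then Two_Blocks \<mu> (2 ^ j - 2 * \<mu>)
             else Two_Blocks (hd ts) (last ts - hd ts + 1)) }"

text \<open>
  The detection rules do not say what to do if no entry is significant. In that case
  \<^const>\<open>detect_two_blocks\<close> keeps the whole range searched, and \<open>detect_from_full\<close> (where this only happens for the zero
  vector) reports the two middle indices as the block. Below, \<open>t\<^sub>1\<close>, \<open>t\<^sub>K\<close>, \<open>t\<^sub>K\<^sub>+\<^sub>1\<close>, \<open>t\<^sub>2\<^sub>K\<close>
  are called \<open>tf\<close>, \<open>tl\<close>, \<open>tr\<close>, \<open>te\<close>.
\<close>

definition detect_from_full :: "real \<Rightarrow> nat \<Rightarrow> vec \<Rightarrow> support comp" where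
  "detect_from_full \<epsilon> j y' = do {
     ts \<leftarrow> filterM (significant \<epsilon> y') [0..<2 ^ (j + 1)];
     return (if ts = [] then One_Block (2 ^ j - 1) 2 else
       let K = length ts div 2;
           tf = hd ts; tl = ts ! (K - 1); tr = ts ! K; te = last ts;
           d0 = tr - tl;
           d1 = (tf + 2 ^ (j + 1) - te) mod 2 ^ (j + 1);
           len0 = te - tf + 1;
           len1 = 2 ^ (j + 1) - tr + tl + 1
       in if d0 = d1 \<or> min len0 len1 > 2 ^ j then One_Block 0 (2 ^ (j + 1))
          else if d0 < d1 then One_Block tf len0
          else One_Block tr len1) }"

definition block_sum :: "nat \<Rightarrow> vec \<Rightarrow> nat \<Rightarrow> nat \<Rightarrow> real comp" where
  "block_sum n y \<mu> m =
     foldM (\<lambda>s i. do { a \<leftarrow> op1 abs (y ((\<mu> + i) mod n)); op2 (+) s a }) 0 [0..<m]"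

definition detect_from_boundary :: "nat \<Rightarrow> vec \<Rightarrow> nat \<Rightarrow> nat \<Rightarrow> support comp" where
  "detect_from_boundary j y' \<mu> m = do {
     s0 \<leftarrow> block_sum (2 ^ (j + 1)) y' \<mu> m;
     s1 \<leftarrow> block_sum (2 ^ (j + 1)) y' (2 ^ j + \<mu>) m;
     b \<leftarrow> op2 (>) s0 s1;
     return (One_Block (if b then \<mu> else 2 ^ j + \<mu>) m) }"

definition one_block_step ::
  "ifft \<Rightarrow> nat \<Rightarrow> real \<Rightarrow> (nat \<Rightarrow> complex) \<Rightarrow> nat \<Rightarrow> vec \<Rightarrow> nat \<Rightarrow> nat
     \<Rightarrow> (vec \<times> support) comp" where
  "one_block_step ifft J \<epsilon> yh j y \<mu> m = do {
     (y', computed) \<leftarrow> (if 2 * m > 2 ^ j then long_block_step ifft J \<epsilon> yh j y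
                        else short_block_step ifft J \<epsilon> yh j y \<mu> m);
     S \<leftarrow> (if m < 2 ^ j \<and> \<mu> < 2 ^ j - \<mu> then detect_two_blocks \<epsilon> j y' \<mu>
           else if j < J - 1 then
             (if m = 2 ^ j then detect_from_full \<epsilon> j y' else detect_from_boundary j y' \<mu> m)
           else do { ts \<leftarrow> filterM (significant \<epsilon> y') computed; return (Explicit ts) });
     return (y', S) }"

text \<open>Among several maximizers, the smallest index is taken.\<close>

definition arg_max_abs :: "complex list \<Rightarrow> nat comp" where
  "arg_max_abs v = do {
     as \<leftarrow> mapM (op1 cmod) v;
     foldM (\<lambda>b k. do { g \<leftarrow> op2 (>) (as ! k) (as ! b); return (if g then k else b) })
       0 [1..<length v] }"

definition two_blocks_step ::
  "nat \<Rightarrow> (nat \<Rightarrow> complex) \<Rightarrow> nat \<Rightarrow> vec \<Rightarrow> nat \<Rightarrow> nat \<Rightarrow> (vec \<times> support) comp" where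
  "two_blocks_step J yh j y \<mu> n = do {
     v \<leftarrow> mapM (\<lambda>k. query yh (2 ^ (J - j - 1) * (2 * k + 1))) [0..<2 * n];
     k0 \<leftarrow> arg_max_abs v;
     let term = (\<lambda>s (l, i). do {
            e \<leftarrow> root_power (2 ^ (j + 1)) (int ((2 * k0 + 1) * l));
            z \<leftarrow> op1 complex_of_real (y i);
            a \<leftarrow> op2 (*) e z;
            op2 (+) s a });
     u \<leftarrow> foldM term 0 (map (\<lambda>l. (l, l)) [\<mu>..<\<mu> + n] @
            map (\<lambda>l. (l, l - 2 ^ j)) [2 ^ (j + 1) - n - \<mu>..<2 ^ (j + 1) - \<mu>]);
     p \<leftarrow> op2 (-) u (v ! k0);
     q \<leftarrow> op2 (+) u (v ! k0);
     p' \<leftarrow> op1 cmod p;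
     q' \<leftarrow> op1 cmod q;
     b \<leftarrow> op2 (<) p' q';
     let lam = (if b then \<mu> else 2 ^ j + \<mu>);
     let idxs = [lam..<lam + n] @ [2 ^ (j + 1) - n - lam..<2 ^ (j + 1) - lam];
     return (scatter idxs (map (\<lambda>k. y (k mod 2 ^ j)) idxs),
             Two_Blocks (if b then \<mu> else 2 ^ j - n - \<mu>) n) }"

definition step ::
  "ifft \<Rightarrow> nat \<Rightarrow> real \<Rightarrow> (nat \<Rightarrow> complex) \<Rightarrow> vec \<times> support \<Rightarrow> nat
     \<Rightarrow> (vec \<times> support) comp" where
  "step ifft J \<epsilon> yh s j = (case s of (y, S) \<Rightarrow>
     (case S of
        One_Block \<mu> m \<Rightarrow> one_block_step ifft J \<epsilon> yh j y \<mu> m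
      | Two_Blocks \<mu> n \<Rightarrow> two_blocks_step J yh j y \<mu> n
      | Explicit ts \<Rightarrow> return s))"

definition sparse_fft ::
  "ifft \<Rightarrow> nat \<Rightarrow> real \<Rightarrow> (nat \<Rightarrow> complex) \<Rightarrow> real list comp" where
  "sparse_fft ifft J \<epsilon> yh = do {
     z \<leftarrow> query yh 0;
     r \<leftarrow> op1 Re z;
     (y, S) \<leftarrow> foldM (step ifft J \<epsilon> yh) (scatter [0] [r], One_Block 0 1) [0..<J];
     return (map y [0..<2 ^ J]) }"

end

theory Submission
  imports Defs
begin

text \<open>
  Write \<open>y\<^sup>j\<close> for the periodization of length \<open>2 ^ j\<close>. Step \<open>j\<close> of the algorithm costs
  \<open>O(k log k)\<close> operations and \<open>O(k)\<close> samples, where \<open>k\<close> is the length of the block that it has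
  recorded. So everything depends on \<open>k = O(min (2 ^ j) m)\<close>. Given this, the levels with
  \<open>2 ^ j \<le> m\<close> contribute a geometric sum and the remaining \<open>log (2 * N / m) + O(1)\<close> levels contribute
  \<open>O(m)\<close> samples each (\<open>sum_width_le\<close>).

  The recorded block starts as the whole vector. Before the last level, a full block at level \<open>j\<close> is
  followed by a full block again or by a proper block, symmetric about the middle or the boundary, of
  length at most \<open>2 ^ j\<close>. A proper block never grows afterwards: it is carried along unchanged, or
  split into two blocks of at most the same length. So it suffices to show that the block can be full
  only while \<open>2 ^ j \<le> 8 * m\<close>.

  While the block is full, only the dense step is used, and it computes \<open>y\<^sup>j\<close> exactly
  (\<open>long_block_step_correct\<close>); by the noise threshold the significant indices then form the support of
  \<open>y\<^sup>j\<close>, which is the support of \<open>x\<close> and its mirror image, reduced modulo \<open>2 ^ j\<close>. From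
  level \<open>2\<close> on, the block stays full only if some of these indices are closer to the middle and
  others closer to the boundary (\<open>detect_from_full_cases\<close>). With \<open>g = 2 ^ (j - 2)\<close>, this means that the window of length \<open>m\<close> that
  carries \<open>x\<close> crosses an odd multiple of \<open>g\<close>. If this happens at two consecutive levels, the window
  contains an odd multiple of \<open>g\<close> and one of \<open>2 * g\<close>, which are at least \<open>g\<close> apart, so \<open>g < m\<close>
  (\<open>spread_twice\<close>). Hence the block becomes proper at the latest one level after \<open>2 ^ j\<close> has
  outgrown \<open>m\<close> by a constant factor (\<open>invariant_from_full\<close>).
\<close>

section \<open>Cost calculus\<close>

lemma comp_simps [simp]:
  "result (return a) = a" "runtime (return a) = 0" "samples (return a) = {}"
  "result (bind_comp c f) = result (f (result c))"
  "runtime (bind_comp c f) = runtime c + runtime (f (result c))"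
  "samples (bind_comp c f) = samples c \<union> samples (f (result c))"
  "result (op1 g a) = g a" "runtime (op1 g a) = 1" "samples (op1 g a) = {}"
  "result (op2 h a b) = h a b" "runtime (op2 h a b) = 1" "samples (op2 h a b) = {}"
  "result (query yh i) = yh i" "runtime (query yh i) = 1" "samples (query yh i) = {i}"
  "result (apply_ifft ifft v) = fst (ifft v)" "runtime (apply_ifft ifft v) = snd (ifft v)"
  "samples (apply_ifft ifft v) = {}"
  by (simp_all add: return_def bind_comp_def op1_def op2_def query_def apply_ifft_def Let_def)

lemma primitive_simps [simp]:
  "result (root_power n e) = omega n powi e" "runtime (root_power n e) = 1"
  "samples (root_power n e) = {}"
  "result (thresholded \<epsilon> r) = (if \<bar>r\<bar> \<le> \<epsilon> then 0 else r)" "runtime (thresholded \<epsilon> r) = 2"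
  "samples (thresholded \<epsilon> r) = {}"
  "result (significant \<epsilon> y k) \<longleftrightarrow> \<bar>y k\<bar> > \<epsilon>" "runtime (significant \<epsilon> y k) = 2"
  "samples (significant \<epsilon> y k) = {}"
  "result (half_Re_sum r z) = (r + Re z) / 2" "runtime (half_Re_sum r z) = 4"
  "samples (half_Re_sum r z) = {}"
  by (simp_all add: root_power_def thresholded_def significant_def half_Re_sum_def)

lemma mapM_simps [simp]:
  "result (mapM f xs) = map (\<lambda>a. result (f a)) xs"
  "runtime (mapM f xs) = (\<Sum>a\<leftarrow>xs. runtime (f a))"
  "samples (mapM f xs) = (\<Union>a\<in>set xs. samples (f a))"
  by (induction xs) simp_all

lemma filterM_simps [simp]:
  "result (filterM p xs) = filter (\<lambda>a. result (p a)) xs"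
  "runtime (filterM p xs) = (\<Sum>a\<leftarrow>xs. runtime (p a))"
  "samples (filterM p xs) = (\<Union>a\<in>set xs. samples (p a))"
  by (induction xs) simp_all

lemma foldM_uniform:
  assumes "\<And>s a. runtime (f s a) = c" "\<And>s a. samples (f s a) = {}"
  shows "runtime (foldM f s xs) = c * length xs" "samples (foldM f s xs) = {}"
  by (induction xs arbitrary: s) (simp_all add: assms)

lemma foldM_snoc: "foldM f s (xs @ [a]) = bind_comp (foldM f s xs) (\<lambda>s'. f s' a)"
  by (induction xs arbitrary: s)
     (simp_all add: return_def bind_comp_def Let_def Un_assoc add.assoc comp.expand)

lemma foldM_invariant:
  fixes R Q :: "nat \<Rightarrow> real"
  assumes "I 0 s"
    and step: "\<And>j s. j < n \<Longrightarrow> I j s \<Longrightarrow>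
      I (Suc j) (result (f s j)) \<and> real (runtime (f s j)) \<le> R j \<and>
      finite (samples (f s j)) \<and> real (card (samples (f s j))) \<le> Q j"
  shows "I n (result (foldM f s [0..<n])) \<and> real (runtime (foldM f s [0..<n])) \<le> (\<Sum>j<n. R j) \<and>
    finite (samples (foldM f s [0..<n])) \<and>
    real (card (samples (foldM f s [0..<n]))) \<le> (\<Sum>j<n. Q j)"
  using step
proof (induction n)
  case 0
  show ?case using assms(1) by simp
next
  case (Suc n)
  let ?c = "foldM f s [0..<n]"
  let ?d = "f (result ?c) n"
  have IH: "I n (result ?c)" "real (runtime ?c) \<le> (\<Sum>j<n. R j)" "finite (samples ?c)"
    "real (card (samples ?c)) \<le> (\<Sum>j<n. Q j)"
    using Suc.IH Suc.prems by auto
  have d: "I (Suc n) (result ?d)" "real (runtime ?d) \<le> R n" "finite (samples ?d)"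
    "real (card (samples ?d)) \<le> Q n"
    using Suc.prems IH(1) by auto
  have "card (samples ?c \<union> samples ?d) \<le> card (samples ?c) + card (samples ?d)"
    by (rule card_Un_le)
  with IH d show ?case by (simp add: foldM_snoc)
qed

section \<open>The discrete Fourier transform\<close>

lemma omega_nonzero [simp]: "omega n \<noteq> 0"
  by (simp add: omega_def)

lemma omega_power: "omega n ^ k = cis (- 2 * pi * real k / real n)"
proof -
  have "omega n = cis (- 2 * pi / real n)"
    by (simp add: omega_def cis_conv_exp mult_ac)
  then show ?thesis by (simp add: DeMoivre mult_ac)
qed

lemma omega_power_self [simp]: "n > 0 \<Longrightarrow> omega n ^ n = 1"
  by (simp add: omega_power complex_eq_iff)

lemma omega_mult_power: "a > 0 \<Longrightarrow> omega (a * b) ^ (a * k) = omega b ^ k"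
  by (simp add: omega_power mult.assoc)

lemma omega_half_power: "n > 0 \<Longrightarrow> omega (2 * n) ^ n = - 1"
  by (simp add: omega_power complex_eq_iff)

lemma omega_power_inj:
  assumes "k < n" "l < n" "omega n ^ k = omega n ^ l"
  shows "k = l"
proof -
  have "cis (2 * pi * real k / real n) = cnj (omega n ^ k)" for k
    unfolding omega_power cis_cnj by simp
  then have "cis (2 * pi * real k / real n) = cis (2 * pi * real l / real n)"
    using assms(3) by (simp only:)
  moreover have "inj_on (\<lambda>k. cis (2 * pi * real k / real n)) {..<n}"
    using bij_betw_roots_unity[of n] assms(1) by (auto simp: bij_betw_def)
  ultimately show ?thesis using assms by (auto dest: inj_onD)
qed

text \<open>
  Orthogonality of the characters of the cyclic group: the ratio of two different powers of the root
  of unity is a root of unity other than \<open>1\<close>, so its geometric sum vanishes.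
\<close>

lemma dft_inversion:
  assumes "p < length v"
  shows "(\<Sum>k<length v. dft v ! k / omega (length v) ^ (k * p)) = of_nat (length v) * v ! p"
proof -
  define n where "n = length v"
  define z where "z l = omega n ^ l / omega n ^ p" for l
  have orth: "(\<Sum>k<n. z l ^ k) = (if l = p then of_nat n else 0)" if "l < n" for l
  proof (cases "l = p")
    case False
    have "z l \<noteq> 1"
      using omega_power_inj[of l n p] that False assms by (auto simp: z_def n_def)
    moreover have "z l ^ n = 1"
    proof -
      have "(omega n ^ i) ^ n = 1" for i
        using that by (metis omega_power_self mult.commute power_mult power_one gr_zeroI not_less_zero)
      then show ?thesis by (simp add: z_def power_divide)
    qed
    ultimately show ?thesis using False by (simp add: geometric_sum)
  qed (simp add: z_def)
  have "(\<Sum>k<n. dft v ! k / omega n ^ (k * p)) = (\<Sum>k<n. \<Sum>l<n. z l ^ k * v ! l)"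
    by (intro sum.cong refl)
       (simp add: dft_def n_def z_def sum_divide_distrib power_divide mult.commute flip: power_mult)
  also have "\<dots> = (\<Sum>l<n. (\<Sum>k<n. z l ^ k) * v ! l)"
    by (subst sum.swap) (simp add: sum_distrib_right)
  also have "\<dots> = (\<Sum>l<n. if l = p then of_nat n * v ! l else 0)"
    by (intro sum.cong refl) (simp add: orth)
  also have "\<dots> = of_nat n * v ! p"
    using assms by (simp add: n_def)
  finally show ?thesis by (simp add: n_def)
qed

lemma dft_inj:
  assumes "length u = length v" "dft u = dft v"
  shows "u = v"
proof (rule nth_equalityI)
  fix p assume "p < length u"
  with dft_inversion[of p u] dft_inversion[of p v] assms show "u ! p = v ! p" by auto
qed (fact assms)

lemma sum_residue_classes:
  fixes f :: "nat \<Rightarrow> 'a::comm_monoid_add"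
  shows "(\<Sum>l<a * b. f l) = (\<Sum>r<a. \<Sum>q<b. f (r + a * q))"
proof -
  have "(\<Sum>l<a * b. f l) = (\<Sum>q<b. \<Sum>l = q * a..<q * a + a. f l)"
    using sum.nat_group[of f a b] by (simp add: mult.commute)
  also have "\<dots> = (\<Sum>q<b. \<Sum>r<a. f (r + a * q))"
  proof (rule sum.cong[OF refl])
    fix q show "(\<Sum>l = q * a..<q * a + a. f l) = (\<Sum>r<a. f (r + a * q))"
    using sum.shift_bounds_nat_ivl[of f 0 "q * a" a]
    by (simp add: lessThan_atLeast0 add.commute mult.commute)
  qed
  also have "\<dots> = (\<Sum>r<a. \<Sum>q<b. f (r + a * q))"
    by (rule sum.swap)
  finally show ?thesis .
qed

lemma sum_lessThan_double:
  fixes f :: "nat \<Rightarrow> 'a::comm_monoid_add"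
  shows "(\<Sum>l<2 * n. f l) = (\<Sum>l<n. f l + f (n + l))"
  using sum_residue_classes[of f n 2] by (simp add: mult.commute numeral_2_eq_2 add.commute)

section \<open>Periodizations\<close>

lemma length_periodization [simp]: "length (periodization J y j) = 2 ^ j"
  by (simp add: periodization_def)

text \<open>
  The step \<open>2 ^ (J - j)\<close> turns the root of order \<open>2 ^ J\<close> into the one of order \<open>2 ^ j\<close>, whose powers
  depend only on the index modulo \<open>2 ^ j\<close>; hence the entries in one residue class are simply added.
\<close>

lemma dft_periodization:
  assumes "length y = 2 ^ J" "j \<le> J" "k < 2 ^ j"
  shows "dft (map complex_of_real (periodization J y j)) ! k =
    dft (map complex_of_real y) ! (2 ^ (J - j) * k)"
proof -
  have J: "(2::nat) ^ J = 2 ^ (J - j) * 2 ^ j" "(2::nat) ^ J = 2 ^ j * 2 ^ (J - j)"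
    using assms(2) by (simp_all flip: power_add)
  have lt: "2 ^ (J - j) * k < (2::nat) ^ J"
    using assms(3) J by simp
  have root: "omega (2 ^ J) ^ (2 ^ (J - j) * k * l) = omega (2 ^ j) ^ (k * l)" for l
    unfolding J(1) mult.assoc by (rule omega_mult_power) simp
  have per: "omega (2 ^ j) ^ (k * (r + 2 ^ j * q)) = omega (2 ^ j) ^ (k * r)" for r q
  proof -
    have "omega (2 ^ j) ^ (k * (r + 2 ^ j * q)) =
        omega (2 ^ j) ^ (k * r) * (omega (2 ^ j) ^ 2 ^ j) ^ (k * q)"
      by (simp only: power_add[symmetric] power_mult[symmetric]) (simp add: algebra_simps)
    then show ?thesis by simp
  qed
  have "dft (map complex_of_real y) ! (2 ^ (J - j) * k) =
      (\<Sum>l<2 ^ J. omega (2 ^ j) ^ (k * l) * of_real (y ! l))"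
    using lt assms(1) by (simp add: dft_def root)
  also have "\<dots> = (\<Sum>r<2 ^ j. \<Sum>q<2 ^ (J - j). omega (2 ^ j) ^ (k * r) * of_real (y ! (r + 2 ^ j * q)))"
    unfolding J(2) sum_residue_classes per ..
  also have "\<dots> = dft (map complex_of_real (periodization J y j)) ! k"
    using assms(3) by (simp add: dft_def periodization_def sum_distrib_left)
  finally show ?thesis ..
qed

text \<open>
  At odd frequencies the second half of the vector is weighted with \<open>omega (2 * n) ^ n = - 1\<close> relative
  to the first half. What remains is a transform of half the length of the difference of the halves,
  modulated by \<open>omega (2 * n) ^ l\<close>.
\<close>

lemma dft_odd_entries:
  assumes "length u = n" "length v = n" "k < n"
  shows "dft (u @ v) ! (2 * k + 1) =
    dft (map (\<lambda>l. omega (2 * n) ^ l * (u ! l - v ! l)) [0..<n]) ! k"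
proof -
  have root: "omega (2 * n) ^ ((2 * k + 1) * l) = omega n ^ (k * l) * omega (2 * n) ^ l" for l
  proof -
    have "omega (2 * n) ^ ((2 * k + 1) * l) = omega (2 * n) ^ (2 * (k * l)) * omega (2 * n) ^ l"
      by (simp add: algebra_simps flip: power_add)
    then show ?thesis by (simp add: omega_mult_power)
  qed
  have half: "omega (2 * n) ^ ((2 * k + 1) * (n + l)) = - (omega (2 * n) ^ ((2 * k + 1) * l))" for l
  proof -
    have "omega (2 * n) ^ ((2 * k + 1) * (n + l)) =
        (omega (2 * n) ^ n) ^ (2 * k + 1) * omega (2 * n) ^ ((2 * k + 1) * l)"
      by (simp only: power_add[symmetric] power_mult[symmetric]) (simp add: algebra_simps)
    then show ?thesis using assms(3) by (simp add: omega_half_power)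
  qed
  have "dft (u @ v) ! (2 * k + 1) =
      (\<Sum>l<2 * n. omega (2 * n) ^ ((2 * k + 1) * l) * (u @ v) ! l)"
    using assms by (simp add: dft_def mult_2)
  also have "\<dots> = (\<Sum>l<n. omega (2 * n) ^ ((2 * k + 1) * l) * (u ! l - v ! l))"
    unfolding sum_lessThan_double half
    using assms by (intro sum.cong) (simp_all add: nth_append right_diff_distrib)
  also have "\<dots> = dft (map (\<lambda>l. omega (2 * n) ^ l * (u ! l - v ! l)) [0..<n]) ! k"
    unfolding root using assms(3) by (simp add: dft_def mult.assoc)
  finally show ?thesis .
qed

text \<open>
  Together with the difference of the two halves, which the odd frequencies reveal, this sum
  determines both halves.
\<close>

lemma periodization_split:
  assumes "j < J" "l < 2 ^ j"
  shows "periodization J y j ! l =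
    periodization J y (j + 1) ! l + periodization J y (j + 1) ! (2 ^ j + l)"
proof -
  have J: "(2::nat) ^ (J - j) = 2 * 2 ^ (J - (j + 1))"
    using assms(1) by (simp add: Suc_diff_Suc flip: power_Suc)
  have "periodization J y j ! l = (\<Sum>q<2 * 2 ^ (J - (j + 1)). y ! (l + 2 ^ j * q))"
    using assms by (simp only: periodization_def J) simp
  also have "\<dots> = (\<Sum>q<2 ^ (J - (j + 1)). y ! (l + 2 ^ (j + 1) * q))
      + (\<Sum>q<2 ^ (J - (j + 1)). y ! (2 ^ j + l + 2 ^ (j + 1) * q))"
    using sum_residue_classes[of "\<lambda>q. y ! (l + 2 ^ j * q)" 2 "2 ^ (J - (j + 1))"]
    by (simp add: numeral_2_eq_2 algebra_simps)
  finally show ?thesis using assms(2) by (simp add: periodization_def)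
qed

lemma reflected_mirror:
  assumes "k + l + 1 = 2 * length x"
  shows "reflected x ! k = reflected x ! l"
proof -
  have "reflected x ! k = rev (reflected x) ! k"
    by (simp add: reflected_def)
  also have "\<dots> = reflected x ! (2 * length x - Suc k)"
    using assms by (subst rev_nth) (simp_all add: reflected_def mult_2)
  also have "2 * length x - Suc k = l"
    using assms by simp
  finally show ?thesis .
qed

text \<open>
  Reflecting an index amounts to reflecting both its position within a period of length \<open>2 ^ j\<close> and
  the number of that period.
\<close>

lemma periodization_reflected:
  assumes "2 * length x = 2 ^ J" "j \<le> J" "k < 2 ^ j"
  shows "periodization J (reflected x) j ! (2 ^ j - 1 - k) = periodization J (reflected x) j ! k"
proof -
  define b where "b = (2::nat) ^ (J - j)"
  have J: "2 ^ j * b = 2 ^ J"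
    using assms(2) by (simp add: b_def flip: power_add)
  have mirror: "reflected x ! (2 ^ j - 1 - k + 2 ^ j * q) = reflected x ! (k + 2 ^ j * (b - Suc q))"
    if "q < b" for q
  proof -
    from that obtain r where r: "b = Suc (q + r)" using less_iff_Suc_add by blast
    have "(2 ^ j - 1 - k + 2 ^ j * q) + (k + 2 ^ j * r) + 1 = 2 * length x"
      using assms(3) J r assms(1) by (simp add: algebra_simps)
    then show ?thesis unfolding r by (intro reflected_mirror) simp
  qed
  have "periodization J (reflected x) j ! (2 ^ j - 1 - k) =
      (\<Sum>q<b. reflected x ! (k + 2 ^ j * (b - Suc q)))"
  proof -
    have "periodization J (reflected x) j ! (2 ^ j - 1 - k) =
        (\<Sum>q<b. reflected x ! (2 ^ j - 1 - k + 2 ^ j * q))"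
      using assms(3) by (simp add: periodization_def b_def)
    also have "\<dots> = (\<Sum>q<b. reflected x ! (k + 2 ^ j * (b - Suc q)))"
      by (intro sum.cong refl mirror) simp
    finally show ?thesis .
  qed
  also have "\<dots> = (\<Sum>q<b. reflected x ! (k + 2 ^ j * q))"
    by (rule sum.nat_diff_reindex)
  finally show ?thesis using assms(3) by (simp add: periodization_def b_def)
qed

section \<open>The dense step\<close>

lemma scatter_upt: "length ws = n \<Longrightarrow> k < n \<Longrightarrow> scatter [0..<n] ws k = ws ! k"
  using map_of_zip_nth[of "[0..<n]" ws k] by (simp add: scatter_def)

lemma periodization_nonzeroD:
  assumes "periodization J y j ! i \<noteq> 0" "i < 2 ^ j" "j \<le> J"
  shows "\<exists>k<2 ^ J. k mod 2 ^ j = i \<and> y ! k \<noteq> 0"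
proof -
  from assms obtain l where l: "l < 2 ^ (J - j)" "y ! (i + 2 ^ j * l) \<noteq> 0"
    by (auto simp: periodization_def elim: sum.not_neutral_contains_not_neutral)
  have "i + 2 ^ j * l < 2 ^ j * Suc l"
    using assms(2) by simp
  also have "\<dots> \<le> 2 ^ j * 2 ^ (J - j)"
    using l(1) by (intro mult_left_mono) auto
  also have "\<dots> = 2 ^ J"
    using assms(3) by (simp flip: power_add)
  finally show ?thesis using l(2) assms(2) by (intro exI[of _ "i + 2 ^ j * l"]) simp
qed

text \<open>
  A nonzero sum has a nonzero summand, to which the noise threshold applies. Thresholding an exact
  periodization therefore changes nothing, and its significant indices are its support.
\<close>

lemma periodization_above_threshold:
  assumes "noise_threshold J y \<epsilon>" "periodization J y j ! i \<noteq> 0" "i < 2 ^ j" "j \<le> J"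
  shows "\<bar>periodization J y j ! i\<bar> > \<epsilon>"
proof -
  obtain k where "k < 2 ^ J" "k mod 2 ^ j = i" "y ! k \<noteq> 0"
    using periodization_nonzeroD assms(2-4) by blast
  then show ?thesis using assms(1,4) by (auto simp: noise_threshold_def)
qed

text \<open>
  The inverse transform of the odd frequencies, demodulated, is the difference of the two halves of the
  next periodization, and the current vector is their sum. Half the sum of these two is the first
  half, and the second half is its mirror image.
\<close>

lemma long_block_step_correct:
  assumes "fast_ifft ifft" "2 * length x = 2 ^ J" "j < J" "noise_threshold J (reflected x) \<epsilon>"
    and y: "\<And>l. l < 2 ^ j \<Longrightarrow> y l = periodization J (reflected x) j ! l"
    and k: "k < 2 ^ (j + 1)"
  shows "fst (result (long_block_step ifft J \<epsilon>
      (\<lambda>k. dft (map complex_of_real (reflected x)) ! k) j y)) k =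
    periodization J (reflected x) (j + 1) ! k"
proof -
  define p where "p = periodization J (reflected x) (j + 1)"
  define u where "u = take (2 ^ j) p"
  have len: "length p = 2 * 2 ^ j" "length u = 2 ^ j"
    by (simp_all add: p_def u_def)
  have p: "p = u @ rev u"
  proof (rule nth_equalityI)
    fix i assume i: "i < length p"
    show "p ! i = (u @ rev u) ! i"
    proof (cases "i < 2 ^ j")
      case False
      have "p ! i = p ! (2 * 2 ^ j - 1 - i)"
        using periodization_reflected[OF assms(2), of "j + 1" i] i assms(3) by (simp add: p_def)
      with False i show ?thesis by (simp add: u_def len nth_append rev_nth flip: mult_2)
    qed (simp add: u_def len nth_append)
  qed (simp add: len)
  define v where "v = map (\<lambda>k. dft (map complex_of_real (reflected x)) !
      (2 ^ (J - j - 1) * (2 * k + 1))) [0..<2 ^ j]"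
  define d where "d = map (\<lambda>l. omega (2 ^ (j + 1)) ^ l * complex_of_real (u ! l - rev u ! l)) [0..<2 ^ j]"
  have "v = dft d"
  proof (rule nth_equalityI)
    fix i assume "i < length v"
    then have i: "i < 2 ^ j" by (simp add: v_def)
    then have "v ! i = dft (map complex_of_real (reflected x)) ! (2 ^ (J - (j + 1)) * (2 * i + 1))"
      by (simp add: v_def)
    also have "\<dots> = dft (map complex_of_real p) ! (2 * i + 1)"
      unfolding p_def using assms(2,3) i
      by (intro dft_periodization[symmetric]) (simp_all add: reflected_def mult_2)
    also have "\<dots> = dft (map complex_of_real (u @ rev u)) ! (2 * i + 1)"
      by (simp only: flip: p)
    also have "\<dots> = dft d ! i"
    proof -
      have "d = map (\<lambda>l. omega (2 * 2 ^ j) ^ l *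
          (map complex_of_real u ! l - map complex_of_real (rev u) ! l)) [0..<2 ^ j]"
        by (simp add: d_def len)
      then show ?thesis
        using dft_odd_entries[of "map complex_of_real u" "2 ^ j" "map complex_of_real (rev u)" i] i
        by (simp add: len)
    qed
    finally show "v ! i = dft d ! i" .
  qed (simp add: v_def d_def dft_def)
  moreover have "dft (fst (ifft v)) = v" "length (fst (ifft v)) = 2 ^ j"
    using assms(1) by (auto simp: fast_ifft_def v_def)
  ultimately have c: "fst (ifft v) = d"
    using dft_inj[of "fst (ifft v)" d] by (simp add: d_def)
  define w where "w = map (\<lambda>l. result (thresholded \<epsilon>
      ((y l + Re (omega (2 ^ (j + 1)) powi (- int l) * fst (ifft v) ! l)) / 2))) [0..<2 ^ j]"
  have "w = u"
  proof (rule nth_equalityI)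
    fix l assume "l < length w"
    then have l: "l < 2 ^ j" by (simp add: w_def)
    have "omega (2 ^ (j + 1)) powi (- int l) * d ! l = complex_of_real (u ! l - rev u ! l)"
      using l by (simp add: d_def power_int_minus)
    moreover have "y l = u ! l + rev u ! l"
      using periodization_split[OF assms(3) l] y[OF l] l
      by (simp add: p_def[symmetric, simplified]) (simp add: p nth_append len)
    moreover have "w ! l = result (thresholded \<epsilon>
        ((y l + Re (omega (2 ^ (j + 1)) powi (- int l) * d ! l)) / 2))"
      using l by (simp add: w_def c)
    ultimately have "w ! l = result (thresholded \<epsilon> (u ! l))"
      by (simp only:) simp
    also have "\<dots> = u ! l"
      using periodization_above_threshold[OF assms(4), of "j + 1" l] l assms(3)
      by (auto simp: p_def[symmetric, simplified]) (auto simp: p nth_append len)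
    finally show "w ! l = u ! l" .
  qed (simp add: w_def len)
  have "fst (result (long_block_step ifft J \<epsilon>
      (\<lambda>k. dft (map complex_of_real (reflected x)) ! k) j y)) = scatter [0..<2 ^ (j + 1)] (w @ rev w)"
    by (simp add: long_block_step_def w_def v_def)
  then show ?thesis
    using k by (simp add: \<open>w = u\<close> scatter_upt len p[symmetric] p_def)
qed

section \<open>Support detection in a full vector\<close>

text \<open>
  These are the proper blocks that the reflection \<open>i \<mapsto> n - 1 - i\<close> maps to themselves. A block
  that starts in the first half lies around the middle; one that starts later wraps around the
  boundary.
\<close>

definition centered_block :: "nat \<Rightarrow> nat \<Rightarrow> nat \<Rightarrow> bool" where
  "centered_block n \<mu> k \<longleftrightarrow> 1 \<le> k \<and> k < n \<and>
     (if \<mu> < n - \<mu> then k = n - 2 * \<mu> else \<mu> < n \<and> k = 2 * (n - \<mu>))"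

text \<open>
  By symmetry the significant indices are determined by those in the first half; let \<open>s\<close> and \<open>t\<close> be the
  smallest and largest of them. The arc around the middle has length \<open>2 * (2 ^ j - s)\<close> and the one
  around the boundary has length \<open>2 * (t + 1)\<close>. Both are too long, or the two gaps agree, only if
  \<open>s\<close> lies in the first and \<open>t\<close> in the second quarter of the vector, that is, if there are significant
  indices closer to the boundary as well as significant indices closer to the middle. The case
  \<open>j = 0\<close> is special because a vector of length \<open>2\<close> has no quarters. Without any significant index
  the block consists of the two middle indices, which is the whole vector exactly for \<open>j = 0\<close>.
\<close>

lemma detect_from_full_cases [consumes 1, case_names full short]:
  assumes sym: "\<forall>i<2 ^ (j + 1). y' (2 ^ (j + 1) - 1 - i) = y' i"
  obtains (full) \<mu> where "result (detect_from_full \<epsilon> j y') = One_Block \<mu> (2 ^ (j + 1))"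
      and "j = 0 \<or> (\<exists>s t. 2 * s < 2 ^ j \<and> 2 ^ j \<le> 2 * t \<and> t < 2 ^ j \<and> \<bar>y' s\<bar> > \<epsilon> \<and> \<bar>y' t\<bar> > \<epsilon>)"
    | (short) \<mu> k where "result (detect_from_full \<epsilon> j y') = One_Block \<mu> k"
      and "centered_block (2 ^ (j + 1)) \<mu> k" "k \<le> 2 ^ j"
proof -
  define h where "h = (2::nat) ^ j"
  have h: "h \<ge> 1" "(2::nat) ^ (j + 1) = 2 * h" by (simp_all add: h_def)
  define P where "P = (\<lambda>i. \<bar>y' i\<bar> > \<epsilon>)"
  define A where "A = filter P [0..<h]"
  define ts where "ts = filter P [0..<2 * h]"
  have "[0..<2 * h] = [0..<h] @ [h..<2 * h]"
    using upt_add_eq_append[of 0 h h] by (simp add: mult_2)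
  \<comment> \<open>The second half lists the mirror images of the first half in reverse order.\<close>
  moreover have "[h..<2 * h] = map (\<lambda>i. 2 * h - 1 - i) (rev [0..<h])"
    by (rule nth_equalityI) (simp_all add: rev_nth)
  moreover have "P (2 * h - 1 - i) = P i" if "i < h" for i
    using sym that unfolding P_def h by auto
  then have "filter (P \<circ> (\<lambda>i. 2 * h - 1 - i)) (rev [0..<h]) = filter P (rev [0..<h])"
    by (intro filter_cong) auto
  ultimately have ts: "ts = A @ map (\<lambda>i. 2 * h - 1 - i) (rev A)"
    by (simp add: ts_def A_def filter_map rev_filter)
  have res0: "result (detect_from_full \<epsilon> j y') = (if ts = [] then One_Block (h - 1) 2 else
      let K = length ts div 2; tf = hd ts; tl = ts ! (K - 1); tr = ts ! K; te = last ts;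
        d0 = tr - tl; d1 = (tf + 2 * h - te) mod (2 * h);
        len0 = te - tf + 1; len1 = 2 * h - tr + tl + 1
      in if d0 = d1 \<or> min len0 len1 > h then One_Block 0 (2 * h)
         else if d0 < d1 then One_Block tf len0 else One_Block tr len1)"
    by (simp only: detect_from_full_def ts_def P_def h_def comp_simps filterM_simps
        primitive_simps power_add power_one_right mult.commute[of _ 2])
  show thesis
  proof (cases "A = []")
    case True
    then have res: "result (detect_from_full \<epsilon> j y') = One_Block (h - 1) 2"
      using ts res0 by simp
    show thesis
    proof (cases "j = 0")
      case True
      with res show thesis by (intro full) auto
    next
      case False
      then have "h \<ge> 2" using power_increasing[of 1 j "2::nat"] by (simp add: h_def)
      with res show thesis by (intro short[of "h - 1" 2]) (auto simp: h centered_block_def h_def[symmetric])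
    qed
  next
    case False
    define s t where "s = hd A" and "t = last A"
    have A: "s \<in> set A" "t \<in> set A" using False by (simp_all add: s_def t_def)
    then have st: "s < h" "t < h" "P s" "P t" by (simp_all add: A_def)
    have "sorted A" unfolding A_def by (intro sorted_wrt_filter) simp
    then have "s \<le> t"
      using False by (cases A) (auto simp: s_def t_def)
    have nth: "ts ! (length ts div 2 - 1) = t" "ts ! (length ts div 2) = 2 * h - 1 - t"
      using False by (simp_all add: ts nth_append t_def last_conv_nth rev_nth)
    have ends: "hd ts = s" "last ts = 2 * h - 1 - s" "ts \<noteq> []"
      using False by (simp_all add: ts s_def last_map last_rev)
    have wrap: "(s + 2 * h - (2 * h - 1 - s)) mod (2 * h) = 2 * s + 1"
      using st by simp
    have "2 * h - 1 - t - t = 2 * (h - t) - 1" "2 * h - 1 - s - s + 1 = 2 * h - 2 * s"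
        "2 * h - (2 * h - 1 - t) + t + 1 = 2 * t + 2"
      using st by simp_all
    then have res: "result (detect_from_full \<epsilon> j y') =
        (if 2 * (h - t) - 1 = 2 * s + 1 \<or> min (2 * h - 2 * s) (2 * t + 2) > h
         then One_Block 0 (2 * h)
         else if 2 * (h - t) - 1 < 2 * s + 1 then One_Block s (2 * h - 2 * s)
         else One_Block (2 * h - 1 - t) (2 * t + 2))"
      using res0 by (simp only: Let_def ends(1,2) nth wrap ends(3) if_False)
    show thesis
    proof (cases "2 * (h - t) - 1 = 2 * s + 1 \<or> min (2 * h - 2 * s) (2 * t + 2) > h")
      case True
      have "2 * s < h \<and> h \<le> 2 * t" if "j \<noteq> 0"
      proof -
        have "even h" using that by (simp add: h_def)
        then obtain g where "h = 2 * g" by (elim evenE)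
        with True st \<open>s \<le> t\<close> show ?thesis by auto
      qed
      then show thesis
        using True res st by (intro full[of 0]) (auto simp: P_def h_def)
    next
      case False
      show thesis
      proof (cases "2 * (h - t) - 1 < 2 * s + 1")
        case True
        with False st have "h - t \<le> s" "2 * h - 2 * s \<le> h" by auto
        with False True res st show thesis
          by (intro short[of s "2 * h - 2 * s"]) (auto simp: centered_block_def h h_def[symmetric])
      next
        case gap: False
        with False st have "2 * t + 2 \<le> h" by auto
        with False gap res st show thesis
          by (intro short[of "2 * h - 1 - t" "2 * t + 2"])
             (auto simp: centered_block_def h h_def[symmetric])
      qed
    qed
  qed
qed

section \<open>Two crossings force a long window\<close>

text \<open>
  The number \<open>(k div g + 1) div 2\<close> is the \<open>c\<close> for which \<open>2 * g * c\<close> is the multiple of \<open>2 * g\<close> closest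
  to \<open>k + 1/2\<close>. In a vector of length \<open>4 * g\<close> with indices shifted by \<open>1/2\<close>, the even multiples of
  \<open>2 * g\<close> are the boundary and the odd ones are the middle, so the predicate says that \<open>k\<close> is closer
  to the boundary than to the middle. In this form it makes sense for indices at all finer levels.
\<close>

definition near_even :: "nat \<Rightarrow> nat \<Rightarrow> bool" where
  "near_even g k \<longleftrightarrow> even ((k div g + 1) div 2)"

lemma near_even_mod:
  assumes "g > 0" shows "near_even g (k mod (4 * g * b)) = near_even g k"
proof -
  define t where "t = k div (4 * g * b)"
  have "k = k mod (4 * g * b) + g * (4 * b * t)"
    by (metis t_def mod_mult_div_eq mult.assoc mult.left_commute)
  then have "k div g = k mod (4 * g * b) div g + 4 * (b * t)"
    using assms by (metis div_mult_self2 mult.assoc neq0_conv add.commute)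
  moreover have "even ((q + 4 * c + 1) div 2) = even ((q + 1) div 2)" for q c :: nat
    by presburger
  ultimately show ?thesis by (simp only: near_even_def)
qed

lemma near_even_mirror:
  assumes "g > 0" "k + l + 1 = 4 * g * b"
  shows "near_even g k = near_even g l"
proof -
  define q where "q = k div g"
  have k: "g * q \<le> k" "k < g * q + g"
    using assms(1) by (simp_all add: q_def dividend_less_times_div add.commute)
  have "g * q < 4 * g * b" using k(1) assms(2) by linarith
  then have "q < 4 * b" by (simp add: mult_ac)
  then obtain e where e: "4 * b = Suc (q + e)"
    using less_iff_Suc_add[of q "4 * b"] by auto
  have "k + l + 1 = g * (4 * b)" using assms(2) by (simp add: mult_ac)
  then have "k + l + 1 = g + g * q + g * e" unfolding e by (simp add: algebra_simps)
  then have "l div g = e" using k by (intro div_nat_eqI) (auto simp: mult_ac)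
  moreover have "even ((q + 1) div 2) = even ((e + 1) div 2)"
    using e by presburger
  ultimately show ?thesis by (simp add: near_even_def q_def)
qed

lemma near_even_first_half:
  assumes "i < 2 * g" shows "near_even g i \<longleftrightarrow> i < g"
proof (cases "i < g")
  case False
  with assms have "i div g = 1" by (intro div_nat_eqI) auto
  with False show ?thesis by (simp add: near_even_def)
qed (simp add: near_even_def)

text \<open>
  The points halfway between neighbouring multiples of \<open>2 * g\<close> are the odd multiples of \<open>g\<close>.
\<close>

lemma odd_multiple_between:
  assumes "near_even g p \<noteq> near_even g q" "p \<le> q"
  shows "\<exists>c. odd c \<and> p < c * g \<and> c * g \<le> q"
proof -
  define e where "e k = (k div g + 1) div 2" for k
  have "g > 0" using assms by (cases g) (auto simp: near_even_def)
  have "e p \<le> e q" unfolding e_def by (intro div_le_mono add_right_mono assms)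
  moreover have "e p \<noteq> e q" using assms(1) unfolding near_even_def e_def by metis
  ultimately have "e p < e q" by simp
  then have "p div g < 2 * e q - 1" "2 * e q - 1 \<le> q div g"
    unfolding e_def by linarith+
  then have "p < (2 * e q - 1) * g" "(2 * e q - 1) * g \<le> q"
    using \<open>g > 0\<close> by (simp_all add: div_less_iff_less_mult less_eq_div_iff_mult_less_eq)
  moreover have "odd (2 * e q - 1)" using \<open>e p < e q\<close> by simp
  ultimately show ?thesis by blast
qed

definition spread :: "nat \<Rightarrow> nat \<Rightarrow> nat \<Rightarrow> bool" where
  "spread g a m \<longleftrightarrow> (\<exists>p\<in>{a..<a + m}. \<exists>q\<in>{a..<a + m}. near_even g p \<noteq> near_even g q)"

text \<open>
  The window contains an odd multiple of \<open>g\<close> and an odd multiple of \<open>2 * g\<close>, and these are at least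
  \<open>g\<close> apart. So a window of length at most \<open>g\<close> cannot be spread at both of these consecutive levels.
\<close>

lemma spread_twice:
  assumes "spread g a m" "spread (2 * g) a m"
  shows "g < m"
proof -
  have *: "\<exists>c. odd c \<and> a < c * g \<and> c * g < a + m" if "spread g a m" for g
  proof -
    from that obtain p q where "p \<in> {a..<a + m}" "q \<in> {a..<a + m}" "near_even g p \<noteq> near_even g q"
      "p \<le> q" unfolding spread_def by (metis linear)
    then show ?thesis using odd_multiple_between[of g p q] by fastforce
  qed
  obtain c where c: "odd c" "a < c * g" "c * g < a + m" using *[OF assms(1)] by blast
  obtain d where d: "a < 2 * d * g" "2 * d * g < a + m"
    using *[OF assms(2)] by (auto simp: mult_ac)
  have "c \<noteq> 2 * d" using c(1) by auto
  then have "c * g + g \<le> 2 * d * g \<or> 2 * d * g + g \<le> c * g"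
    by (metis Suc_leI add.commute linorder_neqE_nat mult_Suc mult_le_mono1)
  then show ?thesis using c d by linarith
qed

section \<open>Cost of the individual steps\<close>

lemma long_block_step_cost:
  fixes ifft J \<epsilon> yh j y
  defines "c \<equiv> long_block_step ifft J \<epsilon> yh j y"
  shows "\<exists>v. length v = 2 ^ j \<and> runtime c = 9 * 2 ^ j + snd (ifft v)"
    and "finite (samples c)" "card (samples c) \<le> 2 ^ j" "length (snd (result c)) = 2 ^ (j + 1)"
proof -
  show "\<exists>v. length v = 2 ^ j \<and> runtime c = 9 * 2 ^ j + snd (ifft v)"
    by (rule exI[of _ "map (\<lambda>k. yh (2 ^ (J - j - 1) * (2 * k + 1))) [0..<2 ^ j]"])
       (simp add: c_def long_block_step_def sum_list_triv)
  have *: "samples c = (\<lambda>k. 2 ^ (J - j - 1) * (2 * k + 1)) ` {..<2 ^ j}"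
    by (auto simp: c_def long_block_step_def)
  show "finite (samples c)" "card (samples c) \<le> 2 ^ j"
    unfolding * by (simp, rule order.trans[OF card_image_le]) simp_all
  show "length (snd (result c)) = 2 ^ (j + 1)"
    by (simp add: c_def long_block_step_def)
qed

lemma short_block_step_cost:
  fixes ifft J \<epsilon> yh j y \<mu> m
  defines "c \<equiv> short_block_step ifft J \<epsilon> yh j y \<mu> m"
  defines "n \<equiv> 2 ^ nat \<lceil>log 2 (real m)\<rceil>"
  shows "\<exists>v. length v = n \<and> runtime c = 11 * n + snd (ifft v)"
    and "finite (samples c)" "card (samples c) \<le> n" "length (snd (result c)) = 2 * n"
proof -
  define L where "L = nat \<lceil>log 2 (real m)\<rceil>"
  have n: "n = 2 ^ L" by (simp add: n_def L_def)
  show "\<exists>v. length v = n \<and> runtime c = 11 * n + snd (ifft v)"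
    unfolding n
    by (rule exI[of _ "map (\<lambda>p. omega (2 ^ L) powi (- int (p * \<mu>)) *
         map (\<lambda>p. yh (2 ^ (J - L) * p + 2 ^ (J - j - 1))) [0..<2 ^ L] ! p) [0..<2 ^ L]"])
       (simp add: c_def short_block_step_def Let_def sum_list_triv L_def[symmetric])
  have *: "samples c = (\<lambda>p. 2 ^ (J - L) * p + 2 ^ (J - j - 1)) ` {..<n}"
    by (auto simp: c_def short_block_step_def Let_def n L_def[symmetric])
  show "finite (samples c)" "card (samples c) \<le> n"
    unfolding * by (simp, rule order.trans[OF card_image_le]) simp_all
  show "length (snd (result c)) = 2 * n"
    by (simp add: c_def short_block_step_def Let_def n L_def[symmetric])
qed

lemma ceiling_power_of_two_less:
  assumes "k \<ge> 1" shows "2 ^ nat \<lceil>log 2 (real k)\<rceil> < 2 * k"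
proof -
  define L where "L = nat \<lceil>log 2 (real k)\<rceil>"
  have "0 \<le> log 2 (real k)" using assms by simp
  then have "real L < log 2 (real k) + 1"
    unfolding L_def by linarith
  then have "2 powr real L < 2 powr (log 2 (real k) + 1)"
    by simp
  then have "real (2 ^ L) < real (2 * k)"
    using assms by (simp add: powr_realpow powr_add)
  then show ?thesis unfolding L_def by linarith
qed

lemma detect_two_blocks_cost:
  "runtime (detect_two_blocks \<epsilon> j y' \<mu>) = 2 * (2 ^ j - 2 * \<mu>)"
  "samples (detect_two_blocks \<epsilon> j y' \<mu>) = {}"
  by (simp_all add: detect_two_blocks_def sum_list_triv mult_2)

lemma detect_two_blocks_length:
  "\<exists>\<nu> n. result (detect_two_blocks \<epsilon> j y' \<mu>) = Two_Blocks \<nu> n \<and> n \<le> 2 ^ j - 2 * \<mu>"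
proof -
  define ts where "ts = filter (\<lambda>i. \<bar>y' i\<bar> > \<epsilon>) [\<mu>..<2 ^ j - \<mu>]"
  have "last ts - hd ts + 1 \<le> 2 ^ j - 2 * \<mu>" if "ts \<noteq> []"
  proof -
    have "hd ts \<in> set ts" "last ts \<in> set ts" using that by simp_all
    then have "\<mu> \<le> hd ts" "\<mu> \<le> last ts" "last ts < 2 ^ j - \<mu>" by (auto simp: ts_def)
    then show ?thesis by linarith
  qed
  then show ?thesis by (simp add: detect_two_blocks_def flip: ts_def)
qed

lemma detect_from_full_cost:
  "runtime (detect_from_full \<epsilon> j y') = 4 * 2 ^ j" "samples (detect_from_full \<epsilon> j y') = {}"
  by (simp_all add: detect_from_full_def sum_list_triv)

lemma detect_from_boundary_cost:
  "runtime (detect_from_boundary j y' \<mu> k) = 4 * k + 1"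
  "samples (detect_from_boundary j y' \<mu> k) = {}"
proof -
  have "runtime (block_sum n y \<nu> k) = 2 * k" "samples (block_sum n y \<nu> k) = {}" for n y \<nu>
    by (simp_all add: block_sum_def foldM_uniform[where c = 2])
  then show "runtime (detect_from_boundary j y' \<mu> k) = 4 * k + 1"
    "samples (detect_from_boundary j y' \<mu> k) = {}"
    by (simp_all add: detect_from_boundary_def)
qed

lemma detect_from_boundary_cases:
  "result (detect_from_boundary j y' \<mu> k) \<in> {One_Block \<mu> k, One_Block (2 ^ j + \<mu>) k}"
  by (simp add: detect_from_boundary_def)

lemma arg_max_abs_cost:
  "runtime (arg_max_abs v) = length v + (length v - 1)" "samples (arg_max_abs v) = {}"
  by (simp_all add: arg_max_abs_def foldM_uniform[where c = 1] sum_list_triv)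

lemma two_blocks_step_cost:
  fixes J yh j y \<mu> n
  defines "c \<equiv> two_blocks_step J yh j y \<mu> n"
  shows "runtime c \<le> 14 * n + 5" "finite (samples c)" "card (samples c) \<le> 2 * n"
    "\<exists>\<nu>. snd (result c) = Two_Blocks \<nu> n"
proof -
  show "runtime c \<le> 14 * n + 5"
    by (simp add: c_def two_blocks_step_def Let_def case_prod_beta foldM_uniform[where c = 4]
        arg_max_abs_cost sum_list_triv)
  have *: "samples c = (\<lambda>k. 2 ^ (J - j - 1) * (2 * k + 1)) ` {..<2 * n}"
    by (auto simp: c_def two_blocks_step_def Let_def case_prod_beta foldM_uniform[where c = 4]
        arg_max_abs_cost)
  show "finite (samples c)" "card (samples c) \<le> 2 * n"
    unfolding * by (simp, rule order.trans[OF card_image_le]) simp_all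
  show "\<exists>\<nu>. snd (result c) = Two_Blocks \<nu> n"
    by (simp add: c_def two_blocks_step_def Let_def case_prod_beta)
qed

text \<open>
  The two phases of a step for one block: the numerical one produces the vector, the combinatorial one
  the support. Costs and block lengths are treated separately for each of them.
\<close>

definition block_vector where
  "block_vector ifft J \<epsilon> yh j y \<mu> m =
     (if 2 * m > 2 ^ j then long_block_step ifft J \<epsilon> yh j y
      else short_block_step ifft J \<epsilon> yh j y \<mu> m)"

definition detect_support where
  "detect_support J \<epsilon> j \<mu> m y' computed =
     (if m < 2 ^ j \<and> \<mu> < 2 ^ j - \<mu> then detect_two_blocks \<epsilon> j y' \<mu>
      else if j < J - 1 then
        (if m = 2 ^ j then detect_from_full \<epsilon> j y' else detect_from_boundary j y' \<mu> m)
      else do { ts \<leftarrow> filterM (significant \<epsilon> y') computed; return (Explicit ts) })"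

lemma one_block_step_simps:
  fixes ifft J \<epsilon> yh j y \<mu> m
  defines "c \<equiv> block_vector ifft J \<epsilon> yh j y \<mu> m"
  defines "d \<equiv> detect_support J \<epsilon> j \<mu> m (fst (result c)) (snd (result c))"
  shows "result (one_block_step ifft J \<epsilon> yh j y \<mu> m) = (fst (result c), result d)"
    "runtime (one_block_step ifft J \<epsilon> yh j y \<mu> m) = runtime c + runtime d"
    "samples (one_block_step ifft J \<epsilon> yh j y \<mu> m) = samples c \<union> samples d"
  unfolding c_def d_def
  by (simp_all add: one_block_step_def block_vector_def detect_support_def case_prod_beta)

section \<open>Block lengths along the levels\<close>

text \<open>
  Indices of the window \<open>{a..<a + m}\<close> are understood modulo \<open>length x\<close>, so the block of \<open>x\<close> may wrap
  around. The constant of the inverse transform is \<open>c\<close>.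
\<close>

locale reflected_block =
  fixes J m a :: nat and x :: "real list" and \<epsilon> :: real and ifft :: ifft and c :: real
  assumes length_x: "2 * length x = 2 ^ J"
    and m_pos: "m \<ge> 1"
    and block: "k < length x \<Longrightarrow> x ! k \<noteq> 0 \<Longrightarrow> \<exists>i<m. k = (a + i) mod length x"
    and noise: "noise_threshold J (reflected x) \<epsilon>"
    and ifft: "fast_ifft ifft"
    and ifft_cost: "length v = 2 ^ q \<Longrightarrow> real (snd (ifft v)) \<le> c * 2 ^ q * max 1 (real q)"
    and c_nonneg: "c \<ge> 0"
begin

abbreviation yh :: "nat \<Rightarrow> complex" where
  "yh \<equiv> \<lambda>k. dft (map complex_of_real (reflected x)) ! k"

abbreviation per :: "nat \<Rightarrow> real list" where
  "per j \<equiv> periodization J (reflected x) j"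

text \<open>
  Level \<open>j\<close> takes at most a multiple of \<open>width j\<close> samples and of \<open>width j * \<Lambda>\<close> operations. The
  bound \<open>m\<close> alone is too weak for small \<open>j\<close>: summed over the first \<open>log m\<close> levels, it would add a
  term \<open>m * log m\<close> to the samples.
\<close>

definition width :: "nat \<Rightarrow> nat" where
  "width j = min (2 ^ j) m"

definition \<Lambda> :: real where
  "\<Lambda> = max 1 (log 2 (real m))"

lemma width_pos: "width j \<ge> 1"
  using m_pos by (simp add: width_def)

lemma \<Lambda>_ge_1: "\<Lambda> \<ge> 1"
  by (simp add: \<Lambda>_def)

text \<open>
  Lengthening the transform by a constant factor adds only a constant to its logarithm:
  \<open>q \<le> 4 + log 2 m \<le> 5 * \<Lambda>\<close>.
\<close>

lemma ifft_runtime: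
  assumes "length v = 2 ^ q" "2 ^ q \<le> 16 * width j"
  shows "real (snd (ifft v)) \<le> 80 * c * width j * \<Lambda>"
proof -
  have "2 powr real q \<le> 2 powr (4 + log 2 (real m))"
  proof -
    have "real (2 ^ q) \<le> real (16 * m)"
      using assms(2) by (subst of_nat_le_iff) (simp add: width_def)
    then show ?thesis using m_pos by (simp add: powr_realpow powr_add)
  qed
  then have "real q \<le> 4 + log 2 (real m)" by simp
  then have q: "max 1 (real q) \<le> 5 * \<Lambda>" unfolding \<Lambda>_def by linarith
  have "real (2 ^ q) \<le> real (16 * width j)"
    using assms(2) by (subst of_nat_le_iff)
  then have "c * 2 ^ q * max 1 (real q) \<le> c * (16 * width j) * (5 * \<Lambda>)"
    using c_nonneg q by (intro mult_mono mult_left_mono) auto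
  with ifft_cost[OF assms(1)] show ?thesis by simp
qed

text \<open>
  Either kind of step transforms a vector whose length is a power of two and at most \<open>2 * k\<close>: the dense
  step is chosen when \<open>2 ^ j < 2 * k\<close>, and otherwise \<open>k\<close> is rounded up to a power of two.
\<close>

lemma block_vector_cost:
  fixes y j \<mu> k
  defines "d \<equiv> block_vector ifft J \<epsilon> yh j y \<mu> k"
  assumes k: "1 \<le> k" "k \<le> 8 * width j"
  shows "real (runtime d) \<le> (176 + 80 * c) * width j * \<Lambda>"
    "finite (samples d)" "card (samples d) \<le> 16 * width j" "length (snd (result d)) \<le> 32 * width j"
proof -
  have "\<exists>q v. 2 ^ q \<le> 16 * width j \<and> length v = 2 ^ q \<and> runtime d \<le> 11 * 2 ^ q + snd (ifft v) \<and>
      finite (samples d) \<and> card (samples d) \<le> 2 ^ q \<and> length (snd (result d)) = 2 * 2 ^ q"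
  proof (cases "2 * k > 2 ^ j")
    case True
    then have "d = long_block_step ifft J \<epsilon> yh j y" by (simp add: d_def block_vector_def)
    moreover have "2 ^ j \<le> 16 * width j" using True k by simp
    ultimately show ?thesis
      using long_block_step_cost[where ifft = ifft and J = J and \<epsilon> = \<epsilon> and yh = yh and j = j and y = y]
      by (intro exI[of _ j]) (fastforce simp flip: power_Suc)
  next
    case False
    then have "d = short_block_step ifft J \<epsilon> yh j y \<mu> k" by (simp add: d_def block_vector_def)
    moreover have "2 ^ nat \<lceil>log 2 (real k)\<rceil> \<le> 16 * width j"
      using ceiling_power_of_two_less[OF k(1)] k(2) by simp
    ultimately show ?thesis
      using short_block_step_cost[where ifft = ifft and J = J and \<epsilon> = \<epsilon> and yh = yh and j = j and y = y
            and \<mu> = \<mu> and m = k]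
      by (intro exI[of _ "nat \<lceil>log 2 (real k)\<rceil>"]) fastforce
  qed
  then obtain q v where q: "2 ^ q \<le> 16 * width j" and v: "length v = 2 ^ q"
    and d: "runtime d \<le> 11 * 2 ^ q + snd (ifft v)" "finite (samples d)" "card (samples d) \<le> 2 ^ q"
      "length (snd (result d)) = 2 * 2 ^ q" by blast
  from d q show "finite (samples d)" "card (samples d) \<le> 16 * width j"
    "length (snd (result d)) \<le> 32 * width j" by auto
  have "real (runtime d) \<le> real (11 * 2 ^ q + snd (ifft v))"
    using d(1) by (subst of_nat_le_iff)
  also have "\<dots> \<le> real (176 * width j) + 80 * c * width j * \<Lambda>"
  proof -
    have "real (11 * 2 ^ q) \<le> real (176 * width j)" using q by (subst of_nat_le_iff) simp
    with ifft_runtime[OF v q] show ?thesis by simp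
  qed
  also have "real (176 * width j) \<le> 176 * width j * \<Lambda>"
    using \<Lambda>_ge_1 by (simp add: mult_le_cancel_left1)
  finally show "real (runtime d) \<le> (176 + 80 * c) * width j * \<Lambda>" by (simp add: algebra_simps)
qed

text \<open>
  A nonzero entry of the periodization comes from a nonzero entry of \<open>x\<close> or of its mirror image, and
  neither periodization nor reflection changes the side on which an index lies.
\<close>

lemma near_even_nonzero_periodization:
  assumes "per j ! i \<noteq> 0" "i < 2 ^ j" "2 \<le> j" "j < J"
  shows "\<exists>p\<in>{a..<a + m}. near_even (2 ^ (j - 2)) p = near_even (2 ^ (j - 2)) i"
proof -
  define g where "g = (2::nat) ^ (j - 2)"
  define b where "b = (2::nat) ^ (J - 1 - j)"
  \<comment> \<open>All moduli that occur, \<open>2 ^ j\<close>, \<open>length x\<close> and \<open>2 * length x\<close>, are multiples of \<open>4 * g\<close>.\<close>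
  have g: "g > 0" "2 ^ j = 4 * g * 1" "length x = 4 * g * b" "2 * length x = 4 * g * (2 * b)"
  proof -
    obtain f where f: "J = Suc (j + f)" using less_imp_Suc_add[OF assms(4)] by blast
    obtain e where e: "j = e + 2" using le_imp_diff_is_add[OF assms(3)] by auto
    show "g > 0" "2 ^ j = 4 * g * 1" "length x = 4 * g * b" "2 * length x = 4 * g * (2 * b)"
      using length_x by (simp_all add: g_def b_def f e power_add)
  qed
  obtain k where k: "k < 2 ^ J" "k mod 2 ^ j = i" "reflected x ! k \<noteq> 0"
    using periodization_nonzeroD[OF assms(1,2)] assms(4) by auto
  have "near_even g k = near_even g i"
    using near_even_mod[of g k 1] g k(2) by simp
  moreover have "\<exists>l<length x. x ! l \<noteq> 0 \<and> near_even g l = near_even g k"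
  proof (cases "k < length x")
    case True
    with k(3) show ?thesis by (auto simp: reflected_def nth_append)
  next
    case False
    define l where "l = 2 * length x - 1 - k"
    have "k + l + 1 = 2 * length x" "l < length x"
      using False k(1) length_x by (auto simp: l_def)
    with k(3) reflected_mirror[of k l x] near_even_mirror[of g k l "2 * b"] g show ?thesis
      by (intro exI[of _ l]) (auto simp: reflected_def nth_append)
  qed
  then obtain l where l: "l < length x" "x ! l \<noteq> 0" "near_even g l = near_even g k" by blast
  obtain p where p: "p < m" "l = (a + p) mod length x" using block[OF l(1,2)] by blast
  have "near_even g (a + p) = near_even g l"
    unfolding p(2) g(3) using near_even_mod[OF g(1)] by simp
  ultimately show ?thesis using p(1) l(3) by (intro bexI[of _ "a + p"]) (auto simp: g_def)
qed

text \<open>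
  As long as the block is the whole vector, the vector has to be the exact periodization, because the
  next support is read off from it; and from level \<open>2\<close> on, the window has to be spread. Once
  the block is proper, the bound on its length is all that matters: later steps never enlarge it.
\<close>

definition invariant :: "nat \<Rightarrow> vec \<times> support \<Rightarrow> bool" where
  "invariant j s = (case snd s of
     One_Block \<mu> k \<Rightarrow> k \<le> 8 * width j \<and>
       (centered_block (2 ^ j) \<mu> k \<or>
        k = 2 ^ j \<and> (\<forall>i<2 ^ j. fst s i = per j ! i) \<and> (2 \<le> j \<longrightarrow> spread (2 ^ (j - 2)) a m))
   | Two_Blocks \<mu> n \<Rightarrow> n \<le> 8 * width j
   | Explicit ts \<Rightarrow> True)"

lemma width_mono: "width j \<le> width (j + 1)"
  by (auto simp: width_def min_def)

lemma detect_support_cost: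
  fixes j \<mu> k y' computed
  defines "d \<equiv> detect_support J \<epsilon> j \<mu> k y' computed"
  assumes "centered_block (2 ^ j) \<mu> k \<or> k = 2 ^ j" "k \<le> 8 * width j" "length computed \<le> 32 * width j"
  shows "real (runtime d) \<le> 64 * width j * \<Lambda>" "samples d = {}"
proof -
  have "runtime d \<le> 64 * width j"
    using assms(2-4) width_pos[of j]
    by (auto simp: d_def detect_support_def detect_two_blocks_cost detect_from_full_cost
        detect_from_boundary_cost sum_list_triv centered_block_def split: if_splits)
  then have "real (runtime d) \<le> 64 * width j" by linarith
  also have "\<dots> \<le> 64 * width j * \<Lambda>" using \<Lambda>_ge_1 by (simp add: mult_le_cancel_left1)
  finally show "real (runtime d) \<le> 64 * width j * \<Lambda>" .
  show "samples d = {}"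
    by (simp add: d_def detect_support_def detect_two_blocks_cost detect_from_full_cost
        detect_from_boundary_cost)
qed

text \<open>
  If the next block is proper, its length is at most \<open>2 ^ j\<close>, the length of the current one. If it
  is full again, the window is spread at two consecutive levels, with \<open>g = 2 ^ (j - 2)\<close>; then
  \<open>g < m\<close>, that is, \<open>2 ^ (j + 1) = 8 * g < 8 * m\<close>. For \<open>j < 2\<close> this bound only needs \<open>1 \<le> m\<close>.
\<close>

lemma invariant_from_full:
  assumes "j < J - 1" and full: "2 \<le> j \<longrightarrow> spread (2 ^ (j - 2)) a m" "2 ^ j \<le> 8 * width j"
    and y': "\<And>i. i < 2 ^ (j + 1) \<Longrightarrow> y' i = per (j + 1) ! i"
  shows "invariant (j + 1) (y', result (detect_from_full \<epsilon> j y'))"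
proof -
  have less: "j + 1 < J" using assms(1) by simp
  have "\<forall>i<2 ^ (j + 1). y' (2 ^ (j + 1) - 1 - i) = y' i"
    using periodization_reflected[OF length_x, of "j + 1"] y' assms(1) by simp
  then show ?thesis
  proof (cases rule: detect_from_full_cases[where \<epsilon> = \<epsilon> and j = j and y' = y'])
    case (full \<mu>)
    have spread': "spread (2 ^ (j - 1)) a m" if j1: "1 \<le> j"
    proof -
      from full(2) j1 obtain s t where st: "2 * s < 2 ^ j" "2 ^ j \<le> 2 * t" "t < 2 ^ j"
        "\<bar>y' s\<bar> > \<epsilon>" "\<bar>y' t\<bar> > \<epsilon>" by auto
      have j: "(2::nat) ^ j = 2 * 2 ^ (j - 1)" using j1 by (cases j) auto
      have "per (j + 1) ! s \<noteq> 0" "per (j + 1) ! t \<noteq> 0"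
        using st y'[of s] y'[of t] noise by (auto simp: noise_threshold_def)
      then obtain p q where pq: "p \<in> {a..<a + m}" "near_even (2 ^ (j - 1)) p = near_even (2 ^ (j - 1)) s"
        "q \<in> {a..<a + m}" "near_even (2 ^ (j - 1)) q = near_even (2 ^ (j - 1)) t"
        using near_even_nonzero_periodization[of "j + 1" s]
          near_even_nonzero_periodization[of "j + 1" t] st j1 less by auto
      have "near_even (2 ^ (j - 1)) s \<noteq> near_even (2 ^ (j - 1)) t"
        using near_even_first_half[of s "2 ^ (j - 1)"] near_even_first_half[of t "2 ^ (j - 1)"] st j
        by auto
      with pq show ?thesis unfolding spread_def by blast
    qed
    have "2 ^ (j + 1) \<le> 8 * m"
    proof (cases "2 \<le> j")
      case True
      then have "2 ^ (j - 2) < m"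
        using assms(2) spread' spread_twice[of "2 ^ (j - 2)" a m]
        by (simp add: Suc_diff_Suc numeral_2_eq_2 flip: power_Suc)
      moreover have "(2::nat) ^ (j + 1) = 8 * 2 ^ (j - 2)"
        using True by (auto simp: le_iff_add power_add)
      ultimately show ?thesis by simp
    next
      case False
      then have "(2::nat) ^ (j + 1) \<le> 2 ^ 2" by (intro power_increasing) auto
      with m_pos show ?thesis by simp
    qed
    then show ?thesis using full(1) spread' y'
      by (auto simp: invariant_def width_def)
  next
    case (short \<mu> k)
    then show ?thesis using assms(3) width_mono[of j] by (simp add: invariant_def)
  qed
qed

lemma invariant_after_detection:
  assumes "j < J" and inv: "invariant j (y, One_Block \<mu> k)"
    and y': "y' = fst (result (block_vector ifft J \<epsilon> yh j y \<mu> k))"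
  shows "invariant (j + 1) (y', result (detect_support J \<epsilon> j \<mu> k y' computed))"
proof -
  have k: "k \<le> 8 * width (j + 1)" using inv width_mono[of j] by (simp add: invariant_def)
  consider (middle) "centered_block (2 ^ j) \<mu> k" "\<mu> < 2 ^ j - \<mu>"
    | (boundary) "centered_block (2 ^ j) \<mu> k" "\<not> \<mu> < 2 ^ j - \<mu>" "j < J - 1"
    | (full) "k = 2 ^ j" "\<forall>i<2 ^ j. y i = per j ! i" "2 \<le> j \<longrightarrow> spread (2 ^ (j - 2)) a m"
        "j < J - 1"
    | (last) "\<not> (k < 2 ^ j \<and> \<mu> < 2 ^ j - \<mu>)" "\<not> j < J - 1"
  proof -
    have "centered_block (2 ^ j) \<mu> k \<or> k = 2 ^ j \<and> (\<forall>i<2 ^ j. y i = per j ! i) \<and>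
        (2 \<le> j \<longrightarrow> spread (2 ^ (j - 2)) a m)"
      using inv by (simp add: invariant_def)
    with that show thesis by (metis less_irrefl)
  qed
  then show ?thesis
  proof cases
    case middle
    then have "result (detect_support J \<epsilon> j \<mu> k y' computed) = result (detect_two_blocks \<epsilon> j y' \<mu>)"
      by (simp add: detect_support_def centered_block_def)
    with detect_two_blocks_length[of \<epsilon> j y' \<mu>] middle k show ?thesis
      by (auto simp: invariant_def centered_block_def)
  next
    case boundary
    then have "result (detect_support J \<epsilon> j \<mu> k y' computed) = result (detect_from_boundary j y' \<mu> k)"
      by (simp add: detect_support_def centered_block_def)
    \<comment> \<open>At level \<open>j + 1\<close>, the start \<open>\<mu>\<close> gives a block around the middle, \<open>2 ^ j + \<mu>\<close> one around the boundary.\<close>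
    with detect_from_boundary_cases[of j y' \<mu> k] boundary k show ?thesis
      by (auto simp: invariant_def centered_block_def)
  next
    case full
    have "y' i = per (j + 1) ! i" if "i < 2 ^ (j + 1)" for i
      using long_block_step_correct[OF ifft length_x assms(1) noise _ that, of y] full(1,2)
      by (simp add: y' block_vector_def)
    with full inv show ?thesis
      using invariant_from_full[of j y']
      by (simp add: detect_support_def invariant_def)
  next
    case last
    then have "result (detect_support J \<epsilon> j \<mu> k y' computed) =
        Explicit (filter (\<lambda>i. \<bar>y' i\<bar> > \<epsilon>) computed)"
      unfolding detect_support_def by (simp only: if_False comp_simps filterM_simps primitive_simps)
    then show ?thesis by (simp add: invariant_def)
  qed
qed

lemma step_bounds:
  assumes "j < J" "invariant j s"
  defines "d \<equiv> step ifft J \<epsilon> yh s j"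
  shows "invariant (Suc j) (result d) \<and> real (runtime d) \<le> (240 + 80 * c) * \<Lambda> * width j \<and>
    finite (samples d) \<and> real (card (samples d)) \<le> 16 * real (width j)"
proof -
  obtain y S where s: "s = (y, S)" by fastforce
  have nonneg: "0 \<le> (240 + 80 * c) * \<Lambda> * width j" using c_nonneg \<Lambda>_ge_1 by simp
  show ?thesis
  proof (cases S)
    case (One_Block \<mu> k)
    define e where "e = block_vector ifft J \<epsilon> yh j y \<mu> k"
    define f where "f = detect_support J \<epsilon> j \<mu> k (fst (result e)) (snd (result e))"
    have d: "result d = (fst (result e), result f)" "runtime d = runtime e + runtime f"
      "samples d = samples e \<union> samples f"
      by (simp_all add: d_def s One_Block step_def one_block_step_simps e_def f_def)
    have k: "k \<le> 8 * width j" "centered_block (2 ^ j) \<mu> k \<or> k = 2 ^ j"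
      using assms(2) by (auto simp: s One_Block invariant_def)
    then have "1 \<le> k" by (auto simp: centered_block_def)
    note e = block_vector_cost[OF this k(1), where \<mu> = \<mu> and y = y, folded e_def]
    note f = detect_support_cost[OF k(2,1) e(4), of "fst (result e)", folded f_def]
    have "invariant (Suc j) (result d)"
      using invariant_after_detection[OF assms(1), of y \<mu> k "fst (result e)"] assms(2)
      by (simp add: d f_def e_def s One_Block)
    moreover have "real (runtime d) \<le> (240 + 80 * c) * \<Lambda> * width j"
      using e(1) f(1) by (simp add: d algebra_simps)
    ultimately show ?thesis using e f by (simp add: d)
  next
    case (Two_Blocks \<mu> n)
    have d: "d = two_blocks_step J yh j y \<mu> n"
      by (simp add: d_def s Two_Blocks step_def)
    note cost = two_blocks_step_cost[of J yh j y \<mu> n, folded d]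
    have n: "n \<le> 8 * width j" using assms(2) by (simp add: invariant_def s Two_Blocks)
    \<comment> \<open>The constant is \<open>117 = 14 * 8 + 5\<close>, with \<open>1 \<le> width j\<close> absorbing the summand \<open>5\<close>.\<close>
    have "runtime d \<le> 117 * width j" using cost(1) n width_pos[of j] by linarith
    then have "real (runtime d) \<le> 117 * real (width j)" by linarith
    also have "117 * real (width j) \<le> (240 + 80 * c) * \<Lambda> * width j"
    proof -
      have "117 * 1 \<le> (240 + 80 * c) * \<Lambda>"
        using c_nonneg \<Lambda>_ge_1 by (intro mult_mono) auto
      then show ?thesis by (intro mult_right_mono) auto
    qed
    finally show ?thesis
      using cost n width_mono[of j] by (auto simp: invariant_def split: support.splits)
  next
    case (Explicit ts)
    then show ?thesis using nonneg by (simp add: d_def s step_def invariant_def)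
  qed
qed

section \<open>Summation over the levels\<close>

lemma log_ratio_ge_1:
  assumes "2 * m < 2 ^ J"
  shows "1 \<le> log 2 (2 ^ J / m)"
proof -
  have "real (2 * m) \<le> real (2 ^ J)"
    using assms by (subst of_nat_le_iff) simp
  then have "2 \<le> 2 ^ J / real m"
    using m_pos by (simp add: field_simps)
  then have "log 2 2 \<le> log 2 (2 ^ J / real m)"
    by (subst log_le_cancel_iff) auto
  then show ?thesis by simp
qed

text \<open>
  The levels \<open>j\<close> with \<open>2 ^ j \<le> m\<close>, apart from the last of them, form a geometric sum of at most \<open>m\<close>. All
  others contribute at most \<open>m\<close> each, and there are at most \<open>J - log 2 m + 1\<close> of them.
\<close>

lemma sum_width_le:
  assumes "2 * m < 2 ^ J"
  shows "real (\<Sum>j<J. width j) \<le> 3 * (m * log 2 (2 ^ J / m))"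
proof -
  obtain q where q: "2 ^ q \<le> m" "m < 2 ^ (q + 1)"
    using ex_power_ivl1[of 2 m] m_pos by auto
  have "q < J"
  proof (rule ccontr)
    assume "\<not> q < J"
    then have "(2::nat) ^ J \<le> 2 ^ q" by (intro power_increasing) auto
    with q(1) assms show False by simp
  qed
  have "(\<Sum>j<J. width j) = (\<Sum>j<q. width j) + (\<Sum>j=q..<J. width j)"
    using \<open>q < J\<close> by (simp add: lessThan_atLeast0 sum.atLeastLessThan_concat)
  also have "(\<Sum>j<q. width j) \<le> (\<Sum>j<q. 2 ^ j)"
    by (intro sum_mono) (simp add: width_def)
  also have "\<dots> \<le> m"
    using q(1) mask_eq_sum_exp_nat[of q] by (simp add: Collect_mem_eq lessThan_def)
  also have "(\<Sum>j=q..<J. width j) \<le> (J - q) * m"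
    using sum_bounded_above[of "{q..<J}" width m] by (simp add: width_def)
  finally have "(\<Sum>j<J. width j) \<le> m + (J - q) * m" by simp
  then have "real (\<Sum>j<J. width j) \<le> real (m + (J - q) * m)"
    by (subst of_nat_le_iff)
  also have "\<dots> = m * (1 + (real J - real q))"
    using of_nat_diff[OF less_imp_le[OF \<open>q < J\<close>], where ?'a = real] by (simp add: distrib_left)
  also have "\<dots> \<le> m * (3 * log 2 (2 ^ J / m))"
  proof (intro mult_left_mono)
    have "real m \<le> real (2 ^ (q + 1))"
      using q(2) by (subst of_nat_le_iff) simp
    then have "real m \<le> 2 powr (real q + 1)"
      by (simp add: powr_add powr_realpow)
    then have "log 2 (real m) \<le> real q + 1"
      using m_pos by (subst log_le_iff) auto
    moreover have "log 2 (2 ^ J / m) = real J - log 2 (real m)"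
      using m_pos by (simp add: log_divide log_nat_power)
    ultimately show "1 + (real J - real q) \<le> 3 * log 2 (2 ^ J / m)"
      using log_ratio_ge_1[OF assms] by linarith
  qed simp
  finally show ?thesis by simp
qed

text \<open>
  The sample at frequency \<open>0\<close> is the sum of all entries, which is the periodization of length \<open>1\<close>.
\<close>

lemma invariant_start: "invariant 0 (scatter [0] [Re (yh 0)], One_Block 0 1)"
proof -
  have "yh 0 = complex_of_real (per 0 ! 0)"
    using dft_periodization[of "reflected x" J 0 0] length_x
    by (simp add: reflected_def dft_def mult_2)
  then show ?thesis
    using width_pos[of 0] by (simp add: invariant_def scatter_def)
qed

text \<open>
  The constants are three times those of a single level, the factor coming from \<open>sum_width_le\<close>, plus the
  cost of the start.
\<close>

theorem sparse_fft_bounds: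
  assumes "2 * m < 2 ^ J"
  defines "run \<equiv> sparse_fft ifft J \<epsilon> yh"
  shows "real (runtime run) \<le> (722 + 240 * c) * (m * \<Lambda> * log 2 (2 ^ J / m))"
    "finite (samples run)" "real (card (samples run)) \<le> 49 * (m * log 2 (2 ^ J / m))"
proof -
  define loop where
    "loop = foldM (step ifft J \<epsilon> yh) (scatter [0] [Re (yh 0)], One_Block 0 1) [0..<J]"
  have run: "runtime run = 2 + runtime loop" "samples run = insert 0 (samples loop)"
    by (simp_all add: run_def sparse_fft_def loop_def case_prod_beta)
  note loop = foldM_invariant[where I = invariant and f = "step ifft J \<epsilon> yh",
      OF invariant_start step_bounds, of J, folded loop_def]
  have fin: "finite (samples loop)"
    and rt: "real (runtime loop) \<le> (\<Sum>j<J. (240 + 80 * c) * \<Lambda> * width j)"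
    and cd: "real (card (samples loop)) \<le> (\<Sum>j<J. 16 * real (width j))"
    using loop by auto
  define s where "s = real (\<Sum>j<J. width j)"
  define t where "t = m * log 2 (2 ^ J / m)"
  have s: "s \<le> 3 * t" using sum_width_le[OF assms(1)] by (simp add: s_def t_def)
  have "1 * 1 \<le> t"
    unfolding t_def using m_pos log_ratio_ge_1[OF assms(1)] by (intro mult_mono) auto
  then have t: "1 \<le> t" by simp
  have "real (runtime loop) \<le> (240 + 80 * c) * \<Lambda> * s"
    using rt by (simp add: s_def sum_distrib_left)
  also have "\<dots> \<le> (240 + 80 * c) * \<Lambda> * (3 * t)"
    using s c_nonneg \<Lambda>_ge_1 by (intro mult_left_mono) auto
  finally have "real (runtime loop) \<le> (720 + 240 * c) * (\<Lambda> * t)"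
    by (simp add: algebra_simps)
  moreover have "1 * 1 \<le> \<Lambda> * t"
    using t \<Lambda>_ge_1 by (intro mult_mono) auto
  ultimately have "real (runtime run) \<le> (722 + 240 * c) * (\<Lambda> * t)"
    by (simp add: run algebra_simps)
  then show "real (runtime run) \<le> (722 + 240 * c) * (m * \<Lambda> * log 2 (2 ^ J / m))"
    by (simp add: t_def mult_ac)
  show "finite (samples run)" using fin by (simp add: run)
  have "real (card (samples run)) \<le> 1 + real (card (samples loop))"
    using card_insert_le_m1 fin by (simp add: run card_insert_if)
  also have "\<dots> \<le> 1 + 16 * s"
    using cd by (simp add: s_def sum_distrib_left)
  finally show "real (card (samples run)) \<le> 49 * (m * log 2 (2 ^ J / m))"
    using s t by (simp add: t_def)
qed

end

lemma periodic_interval_of_length: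
  assumes "1 \<le> m" "m \<le> n" "\<mu> < n"
  shows "periodic_interval n \<mu> ((\<mu> + m - 1) mod n) = {(\<mu> + i) mod n | i. i < m}"
proof -
  have "((\<mu> + m - 1) mod n + n - \<mu>) mod n = m - 1"
  proof (cases "\<mu> + m - 1 < n")
    case True
    then have "(\<mu> + m - 1) mod n + n - \<mu> = m - 1 + n" using assms(1) by simp
    then have "((\<mu> + m - 1) mod n + n - \<mu>) mod n = (m - 1) mod n"
      by (simp only: mod_add_self2)
    with assms show ?thesis by simp
  next
    case False
    then have "(\<mu> + m - 1) mod n = \<mu> + m - 1 - n"
      using assms by (simp add: mod_if)
    with False assms show ?thesis by simp
  qed
  moreover have "i \<le> m - 1 \<longleftrightarrow> i < m" for i using assms(1) by auto
  ultimately show ?thesis by (simp add: periodic_interval_def)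
qed

theorem theorem5p1:
  fixes ifft :: ifft
  assumes "fast_ifft ifft"
  shows "\<exists>C::real. \<forall>(J::nat) (N::nat) (x::real list) (m::nat) (y::real list) (\<epsilon>::real).
           J \<ge> 2 \<longrightarrow> N = 2 ^ (J - 1) \<longrightarrow> length x = N \<longrightarrow>
           one_block_support x m \<longrightarrow> m < N \<longrightarrow> y = reflected x \<longrightarrow>
           non_cancelling J y \<longrightarrow> noise_threshold J y \<epsilon> \<longrightarrow>
           (let run = sparse_fft ifft J \<epsilon> (\<lambda>k. dft (map complex_of_real y) ! k) in
              real (runtime run)
                \<le> C * (real m * max 1 (log 2 (real m)) * log 2 (2 * real N / real m)) \<and>
              finite (samples run) \<and>
              real (card (samples run)) \<le> C * (real m * log 2 (2 * real N / real m)))"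
proof -
  obtain c :: real where c: "\<And>q v. length v = 2 ^ q \<Longrightarrow>
      real (snd (ifft v)) \<le> c * real (length v) * max 1 (log 2 (real (length v)))"
    using assms unfolding fast_ifft_def by blast
  have cost: "real (snd (ifft v)) \<le> c * 2 ^ q * max 1 (real q)" if "length v = 2 ^ q" for q v
    using c[OF that] that by (simp add: log_nat_power)
  have nonneg: "0 \<le> c"
    using order_trans[OF of_nat_0_le_iff cost[of "[0]" 0]] by simp
  show ?thesis
  proof (intro exI[of _ "722 + 240 * c"] allI impI)
    fix J N m :: nat and x y :: "real list" and \<epsilon> :: real
    assume J: "J \<ge> 2" and N: "N = 2 ^ (J - 1)" "length x = N" and supp: "one_block_support x m"
      and m: "m < N" and y: "y = reflected x" and noise: "noise_threshold J y \<epsilon>"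
    have N2: "2 * N = 2 ^ J" using J N(1) by (cases J) auto
    obtain a where a: "a < N" "1 \<le> m" "m \<le> N"
      "\<forall>k<N. k \<notin> periodic_interval N a ((a + m - 1) mod N) \<longrightarrow> x ! k = 0"
      using supp N(2) by (auto simp: one_block_support_def supported_in_block_def)
    interpret reflected_block J m a x \<epsilon> ifft c
      using a N(2) N2 J noise assms cost nonneg periodic_interval_of_length[of m N a]
      by unfold_locales (auto simp: y)
    have "2 * m < 2 ^ J" using m N2 by simp
    note bounds = sparse_fft_bounds[OF this]
    have "2 * real N = 2 ^ J" using N2 by (metis of_nat_mult of_nat_numeral of_nat_power)
    moreover have "49 * (m * log 2 (2 ^ J / m)) \<le> (722 + 240 * c) * (m * log 2 (2 ^ J / m))"
      using log_ratio_ge_1[OF \<open>2 * m < 2 ^ J\<close>] c_nonneg by (intro mult_right_mono) auto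
    ultimately show "let run = sparse_fft ifft J \<epsilon> (\<lambda>k. dft (map complex_of_real y) ! k) in
        real (runtime run)
          \<le> (722 + 240 * c) * (real m * max 1 (log 2 (real m)) * log 2 (2 * real N / real m)) \<and>
        finite (samples run) \<and>
        real (card (samples run)) \<le> (722 + 240 * c) * (real m * log 2 (2 * real N / real m))"
      using bounds by (simp add: Let_def y \<Lambda>_def)
  qed
qed

end
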